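(* Let $M=\mathbb{R}^3$ with coordinates $(x_1,x_2,x_3)$ and let $\nabla$ be the torsion free connection on $M$ whose only non-zero Christoffel symbol is given by $\nabla_{\partial_1}\partial_1=x_2\partial_3$. Let $g:=g_{\nabla,1}$ be the modified Riemannian extension (with $c=1$, $\Phi=0$) on $T^*M$. Then: (1) $g$ is an Osserman metric of signature $(3,3)$ with eigenvalues $\{0,1,\frac14,\frac14,\frac14,\frac14\}$ (counted with multiplicity); (2) $g$ is neither spacelike Jordan Osserman nor timelike Jordan Osserman at any point of $T^*M$; (3) the Jacobi operator $\mathcal{J}^g(v)$ is neither diagonalizable nor nilpotent for a generic tangent vector $v$.
   Context: Local coordinates $(x_i)$ on $M$ induce coordinates $(x_i,x_{i'})$ on $T^*M$ by writing a covector as $\omega=\sum_i x_{i'}dx^i$. With $\xi_1\circ\xi_2=\frac12(\xi_1\otimes\xi_2+\xi_2\otimes\xi_1)$, $\nabla_{\partial_i}\partial_j=\Gamma^\nabla_{ij}{}^k\partial_k$, and summation over repeated indices, the modified Riemannian extension $g_{\nabla,c}$ on $T^*M$ is $$g_{\nabla,c}=2\,dx^i\circ dx^{i'}+\{c\,x_{i'}x_{j'}-2x_{k'}\Gamma^\nabla_{ij}{}^k\}\,dx^i\circ dx^j .$$ Explicitly, here $g=2\,dx^i\circ dx^{i'}+B_{ij}\,dx^i\circ dx^j$ with $B_{11}=x_{1'}^2-2x_2x_{3'}$ and $B_{ij}=x_{i'}x_{j'}$ for all other $(i,j)$, $1\le i,j\le 3$. With $R^g(X,Y)=\nabla^g_X\nabla^g_Y-\nabla^g_Y\nabla^g_X-\nabla^g_{[X,Y]}$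 the curvature of the Levi-Civita connection, the Jacobi operator is $\mathcal{J}^g(v):Y\mapsto R^g(Y,v)v$, an endomorphism of the full tangent space. A pseudo-Riemannian metric is spacelike (resp. timelike) Osserman if the eigenvalues of $\mathcal{J}^g(v)$, with multiplicity, are constant on the bundle of unit spacelike vectors, $g(v,v)=1$ (resp. unit timelike vectors, $g(v,v)=-1$); in indefinite signature these two conditions are equivalent and the metric is called Osserman. The eigenvalues of $\mathcal{J}^g(v)$ change sign between spacelike and timelike unit vectors; "with eigenvalues $\{\dots\}$" refers to the eigenvalues of $g(v,v)^{-1}\mathcal{J}^g(v)$ for non-null $v$. A metric is spacelike (resp. timelike) Jordan Osserman at a point $P$ if the Jordan normal form of $\mathcal{J}^g(v)$ is constant for $v$ in the set of unit spacelike (resp. unit timelike) vectors of the tangent space at $P$. "Generic tangent vector" means: at each point $P$ of $T^*M$, for all $v$ in some dense open subset of $T_P(T^*M)$. *)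

theory Defs
  imports
    "HOL-Analysis.Analysis"
    "Jordan_Normal_Form.Jordan_Normal_Form"
begin

no_notation Matrix.vec_index (infixl "$" 100)

section \<open>Affine connections and pseudo-Riemannian metrics in global coordinates\<close>

text \<open>
  All manifolds here are coordinate spaces \<open>real ^ 'n\<close>; every tangent space is identified with
  \<open>real ^ 'n\<close> through the coordinate frame \<open>\<partial>\<^sub>i = axis i 1\<close>. A connection is given by its
  Christoffel symbols: \<open>\<Gamma> p i j\<close> is the vector \<open>\<nabla>\<^bsub>\<partial>\<^sub>i\<^esub> \<partial>\<^sub>j\<close> at \<open>p\<close>, so that the usual
  \<open>\<Gamma>\<^bsub>i j\<^esub>\<^bsup>k\<^esup>\<close> is \<open>\<Gamma> p i j $ k\<close>.
\<close>

type_synonym 'n vector_field = "real ^ 'n \<Rightarrow> real ^ 'n"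
type_synonym 'n connection = "real ^ 'n \<Rightarrow> 'n \<Rightarrow> 'n \<Rightarrow> real ^ 'n"
type_synonym 'n metric_field = "real ^ 'n \<Rightarrow> real ^ 'n \<Rightarrow> real ^ 'n \<Rightarrow> real"

definition covariant_deriv ::
  "'n::finite connection \<Rightarrow> 'n vector_field \<Rightarrow> 'n vector_field \<Rightarrow> 'n vector_field" where
  "covariant_deriv \<Gamma> X Y p =
     frechet_derivative Y (at p) (X p) + (\<Sum>i\<in>UNIV. \<Sum>j\<in>UNIV. (X p $ i * Y p $ j) *\<^sub>R \<Gamma> p i j)"

definition lie_bracket :: "'n::finite vector_field \<Rightarrow> 'n vector_field \<Rightarrow> 'n vector_field" where
  "lie_bracket X Y p = frechet_derivative Y (at p) (X p) - frechet_derivative X (at p) (Y p)"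

definition curvature ::
  "'n::finite connection \<Rightarrow> 'n vector_field \<Rightarrow> 'n vector_field \<Rightarrow> 'n vector_field \<Rightarrow> 'n vector_field"
  where
  "curvature \<Gamma> X Y Z p =
     covariant_deriv \<Gamma> X (covariant_deriv \<Gamma> Y Z) p
     - covariant_deriv \<Gamma> Y (covariant_deriv \<Gamma> X Z) p
     - covariant_deriv \<Gamma> (lie_bracket X Y) Z p"

definition torsion_free :: "'n::finite connection \<Rightarrow> bool" where
  "torsion_free \<Gamma> \<longleftrightarrow>
     (\<forall>X Y. X differentiable_on UNIV \<longrightarrow> Y differentiable_on UNIV \<longrightarrow>
        (\<forall>p. covariant_deriv \<Gamma> X Y p - covariant_deriv \<Gamma> Y X p = lie_bracket X Y p))"

definition metric_compatible :: "'n::finite metric_field \<Rightarrow> 'n connection \<Rightarrow> bool" where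
  "metric_compatible g \<Gamma> \<longleftrightarrow>
     (\<forall>X Y Z. X differentiable_on UNIV \<longrightarrow> Y differentiable_on UNIV \<longrightarrow> Z differentiable_on UNIV \<longrightarrow>
        (\<forall>p. frechet_derivative (\<lambda>q. g q (Y q) (Z q)) (at p) (X p)
             = g p (covariant_deriv \<Gamma> X Y p) (Z p) + g p (Y p) (covariant_deriv \<Gamma> X Z p)))"

primrec times_differentiable :: "nat \<Rightarrow> (real ^ 'n::finite \<Rightarrow> real) \<Rightarrow> bool" where
  "times_differentiable 0 f \<longleftrightarrow> True"
| "times_differentiable (Suc k) f \<longleftrightarrow>
     f differentiable_on UNIV \<and> (\<forall>v. times_differentiable k (\<lambda>p. frechet_derivative f (at p) v))"

definition smooth :: "(real ^ 'n::finite \<Rightarrow> real) \<Rightarrow> bool" where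
  "smooth f \<longleftrightarrow> (\<forall>k. times_differentiable k f)"

definition pseudo_riemannian :: "'n::finite metric_field \<Rightarrow> bool" where
  "pseudo_riemannian g \<longleftrightarrow>
     (\<forall>u v. smooth (\<lambda>p. g p u v)) \<and>
     (\<forall>p. bilinear (g p) \<and> (\<forall>u v. g p u v = g p v u) \<and> (\<forall>u. (\<forall>v. g p u v = 0) \<longrightarrow> u = 0))"

text \<open>
  \<open>e\<close> is a pseudo-orthonormal basis with \<open>r\<close> timelike and \<open>s\<close> spacelike members; for bilinear
  \<open>B\<close> the linear independence of the \<open>e i\<close> follows from the stated conditions.
\<close>
definition has_signature :: "(real ^ 'n::finite \<Rightarrow> real ^ 'n \<Rightarrow> real) \<Rightarrow> nat \<Rightarrow> nat \<Rightarrow> bool" where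
  "has_signature B r s \<longleftrightarrow> r + s = CARD('n) \<and>
     (\<exists>e :: 'n \<Rightarrow> real ^ 'n. (\<forall>i j. i \<noteq> j \<longrightarrow> B (e i) (e j) = 0) \<and>
        card {i. B (e i) (e i) = -1} = r \<and> card {i. B (e i) (e i) = 1} = s)"

definition levi_civita :: "'n::finite metric_field \<Rightarrow> 'n connection" where
  "levi_civita g = (THE \<Gamma>. torsion_free \<Gamma> \<and> metric_compatible g \<Gamma>)"

text \<open>
  The curvature is tensorial, so its value on tangent vectors at \<open>p\<close> may be computed with the
  extensions of these vectors by constant coefficients.
\<close>
definition jacobi :: "'n::finite metric_field \<Rightarrow> real ^ 'n \<Rightarrow> real ^ 'n \<Rightarrow> real ^ 'n \<Rightarrow> real ^ 'n" where
  "jacobi g p v y = curvature (levi_civita g) (\<lambda>_. y) (\<lambda>_. v) (\<lambda>_. v) p"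


section \<open>Eigenvalues and Jordan normal form of endomorphisms\<close>

text \<open>
  The complexified matrix with respect to the standard basis, ordered by the enumeration of the
  index type. This order is irrelevant for the eigenvalues and for the Jordan normal form.
\<close>
definition complex_matrix :: "(real ^ ('n::enum) \<Rightarrow> real ^ ('n::enum)) \<Rightarrow> complex Matrix.mat" where
  "complex_matrix f = Matrix.mat CARD('n) CARD('n)
     (\<lambda>(r, s). complex_of_real (f (axis (Enum.enum ! s) 1) $ (Enum.enum ! r)))"

definition eigenvalue_mset :: "(real ^ ('n::enum) \<Rightarrow> real ^ ('n::enum)) \<Rightarrow> complex multiset" where
  "eigenvalue_mset f = proots (char_poly (complex_matrix f))"

definition diagonalizable :: "(real ^ 'n::finite \<Rightarrow> real ^ 'n) \<Rightarrow> bool" where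
  "diagonalizable f \<longleftrightarrow>
     (\<exists>B. independent B \<and> span B = UNIV \<and> (\<forall>b\<in>B. \<exists>a::real. f b = a *\<^sub>R b))"

definition nilpotent :: "(real ^ 'n::finite \<Rightarrow> real ^ 'n) \<Rightarrow> bool" where
  "nilpotent f \<longleftrightarrow> (\<exists>k. \<forall>x. (f ^^ k) x = 0)"


section \<open>Osserman conditions\<close>

definition spacelike_osserman :: "'n::enum metric_field \<Rightarrow> bool" where
  "spacelike_osserman g \<longleftrightarrow>
     (\<exists>E. \<forall>p v. g p v v = 1 \<longrightarrow> eigenvalue_mset (jacobi g p v) = E)"

definition timelike_osserman :: "'n::enum metric_field \<Rightarrow> bool" where
  "timelike_osserman g \<longleftrightarrow>
     (\<exists>E. \<forall>p v. g p v v = -1 \<longrightarrow> eigenvalue_mset (jacobi g p v) = E)"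

definition osserman :: "'n::enum metric_field \<Rightarrow> bool" where
  "osserman g \<longleftrightarrow> spacelike_osserman g \<and> timelike_osserman g"

text \<open>A list \<open>J\<close> of Jordan blocks represents the normal form up to the order of the blocks.\<close>
definition spacelike_jordan_osserman_at :: "'n::enum metric_field \<Rightarrow> real ^ ('n::enum) \<Rightarrow> bool" where
  "spacelike_jordan_osserman_at g p \<longleftrightarrow>
     (\<exists>J. \<forall>v. g p v v = 1 \<longrightarrow> jordan_nf (complex_matrix (jacobi g p v)) J)"

definition timelike_jordan_osserman_at :: "'n::enum metric_field \<Rightarrow> real ^ ('n::enum) \<Rightarrow> bool" where
  "timelike_jordan_osserman_at g p \<longleftrightarrow>
     (\<exists>J. \<forall>v. g p v v = -1 \<longrightarrow> jordan_nf (complex_matrix (jacobi g p v)) J)"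


section \<open>Modified Riemannian extensions\<close>

text \<open>
  The cotangent bundle of \<open>real ^ 'n\<close> has coordinates indexed by \<open>'n + 'n\<close>: \<open>Inl i\<close> is the base
  coordinate \<open>x\<^sub>i\<close> and \<open>Inr i\<close> the fibre coordinate \<open>x\<^bsub>i'\<^esub>\<close>.
\<close>

definition sym_product ::
  "('a \<Rightarrow> real) \<Rightarrow> ('a \<Rightarrow> real) \<Rightarrow> 'a \<Rightarrow> 'a \<Rightarrow> real" where
  "sym_product \<xi> \<eta> u v = (\<xi> u * \<eta> v + \<eta> u * \<xi> v) / 2"

definition base_point :: "real ^ ('n + 'n) \<Rightarrow> real ^ 'n::finite" where
  "base_point p = (\<chi> i. p $ Inl i)"

definition modified_riemannian_extension ::
  "real \<Rightarrow> 'n::finite connection \<Rightarrow> ('n + 'n) metric_field" where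
  "modified_riemannian_extension c \<Gamma> p u v =
     2 * (\<Sum>i\<in>UNIV. sym_product (\<lambda>w. w $ Inl i) (\<lambda>w. w $ Inr i) u v)
     + (\<Sum>i\<in>UNIV. \<Sum>j\<in>UNIV.
          (c * p $ Inr i * p $ Inr j - 2 * (\<Sum>k\<in>UNIV. p $ Inr k * \<Gamma> (base_point p) i j $ k))
          * sym_product (\<lambda>w. w $ Inl i) (\<lambda>w. w $ Inl j) u v)"

definition nabla :: "3 connection" where
  "nabla x i j = (if i = 1 \<and> j = 1 then x $ 2 *\<^sub>R axis 3 1 else 0)"


section \<open>Existence and uniqueness of the Levi-Civita connection\<close>

lemma differentiable_on_const_field: "(\<lambda>_. c) differentiable_on S"
  by simp

lemma covariant_deriv_frame:
  "covariant_deriv \<Gamma> (\<lambda>_. axis i 1) (\<lambda>_. axis j 1) p = \<Gamma> p i j"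
proof -
  have "(axis i 1 $ a * axis j 1 $ b) *\<^sub>R \<Gamma> p a b = (if b = j then if a = i then \<Gamma> p a j else 0 else 0)"
    for a b by (simp add: axis_def)
  then show ?thesis
    by (simp add: covariant_deriv_def)
qed

lemma torsion_free_iff: "torsion_free \<Gamma> \<longleftrightarrow> (\<forall>p i j. \<Gamma> p i j = \<Gamma> p j i)"
proof
  assume t: "torsion_free \<Gamma>"
  show "\<forall>p i j. \<Gamma> p i j = \<Gamma> p j i"
  proof (intro allI)
    fix p i j
    have "covariant_deriv \<Gamma> (\<lambda>_. axis i 1) (\<lambda>_. axis j 1) p
          - covariant_deriv \<Gamma> (\<lambda>_. axis j 1) (\<lambda>_. axis i 1) p
          = lie_bracket (\<lambda>_. axis i 1) (\<lambda>_. axis j 1) p"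
      using t unfolding torsion_free_def by (blast intro: differentiable_on_const_field)
    then show "\<Gamma> p i j = \<Gamma> p j i"
      by (simp add: covariant_deriv_frame lie_bracket_def)
  qed
next
  assume s: "\<forall>p i j. \<Gamma> p i j = \<Gamma> p j i"
  have "(\<Sum>i\<in>UNIV. \<Sum>j\<in>UNIV. (X p $ i * Y p $ j) *\<^sub>R \<Gamma> p i j)
      = (\<Sum>i\<in>UNIV. \<Sum>j\<in>UNIV. (Y p $ i * X p $ j) *\<^sub>R \<Gamma> p i j)" for X Y p
    by (subst sum.swap) (use s in \<open>auto intro!: sum.cong simp: mult.commute\<close>)
  then show "torsion_free \<Gamma>"
    by (simp add: torsion_free_def covariant_deriv_def lie_bracket_def)
qed

lemma torsion_free_nabla: "torsion_free nabla"
  by (simp add: torsion_free_iff nabla_def conj_commute)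

lemma smooth_imp_differentiable: "smooth f \<Longrightarrow> f differentiable (at p)"
  unfolding smooth_def by (metis UNIV_I differentiable_on_def times_differentiable.simps(2))

lemma vec_eq_sum_axis: "(x :: real ^ 'n::finite) = (\<Sum>i\<in>UNIV. x $ i *\<^sub>R axis i 1)"
  using basis_expansion[of x] by (simp add: scalar_mult_eq_scaleR)

lemma bilinear_eq_sum_axis:
  fixes B :: "real ^ 'n::finite \<Rightarrow> real ^ 'n \<Rightarrow> real"
  assumes "bilinear B"
  shows "B u v = (\<Sum>i\<in>UNIV. \<Sum>j\<in>UNIV. u $ i * v $ j * B (axis i 1) (axis j 1))"
proof -
  have "B u v = B (\<Sum>i\<in>UNIV. u $ i *\<^sub>R axis i 1) (\<Sum>j\<in>UNIV. v $ j *\<^sub>R axis j 1)"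
    using vec_eq_sum_axis by metis
  also have "\<dots> = (\<Sum>(i,j)\<in>UNIV \<times> UNIV. B (u $ i *\<^sub>R axis i 1) (v $ j *\<^sub>R axis j 1))"
    by (rule bilinear_sum[OF assms])
  also have "\<dots> = (\<Sum>i\<in>UNIV. \<Sum>j\<in>UNIV. u $ i * v $ j * B (axis i 1) (axis j 1))"
    by (simp add: sum.cartesian_product bilinear_lmul[OF assms] bilinear_rmul[OF assms]
        case_prod_unfold algebra_simps)
  finally show ?thesis .
qed

lemma metric_compatible_iff:
  assumes g: "pseudo_riemannian g"
  shows "metric_compatible g \<Gamma> \<longleftrightarrow>
    (\<forall>p i j k. frechet_derivative (\<lambda>q. g q (axis i 1) (axis j 1)) (at p) (axis k 1)
       = g p (\<Gamma> p k i) (axis j 1) + g p (axis i 1) (\<Gamma> p k j))" (is "_ \<longleftrightarrow> ?R")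
proof
  assume m: "metric_compatible g \<Gamma>"
  show ?R
  proof (intro allI)
    fix p i j k
    show "frechet_derivative (\<lambda>q. g q (axis i 1) (axis j 1)) (at p) (axis k 1)
       = g p (\<Gamma> p k i) (axis j 1) + g p (axis i 1) (\<Gamma> p k j)"
      using m[unfolded metric_compatible_def, rule_format,
          of "\<lambda>_. axis k 1" "\<lambda>_. axis i 1" "\<lambda>_. axis j 1" p]
      by (simp add: covariant_deriv_frame)
  qed
next
  assume R: ?R
  have bil: "bilinear (g p)" for p using g by (simp add: pseudo_riemannian_def)
  show "metric_compatible g \<Gamma>"
    unfolding metric_compatible_def
  proof (intro allI impI)
    fix X Y Z :: "'a vector_field" and p
    assume "X differentiable_on UNIV" and Y: "Y differentiable_on UNIV" and Z: "Z differentiable_on UNIV"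
    define DY where "DY = frechet_derivative Y (at p)"
    define DZ where "DZ = frechet_derivative Z (at p)"
    define G where "G i j = (\<lambda>q. g q (axis i 1) (axis j 1))" for i j
    define DG where "DG i j = frechet_derivative (G i j) (at p)" for i j
    have DY: "(Y has_derivative DY) (at p)" and DZ: "(Z has_derivative DZ) (at p)"
      using Y Z unfolding DY_def DZ_def differentiable_on_def by (simp_all add: frechet_derivative_works)
    have DG: "(G i j has_derivative DG i j) (at p)" for i j
      using g unfolding DG_def G_def
      by (simp add: frechet_derivative_works[symmetric] smooth_imp_differentiable pseudo_riemannian_def)
    have lDG: "DG i j w = (\<Sum>k\<in>UNIV. w $ k * DG i j (axis k 1))" for i j w
    proof -
      have lin: "linear (DG i j)" using DG has_derivative_linear by blast
      have "DG i j w = DG i j (\<Sum>k\<in>UNIV. w $ k *\<^sub>R axis k 1)" using vec_eq_sum_axis by metis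
      then show ?thesis by (simp add: linear_sum[OF lin] linear_cmul[OF lin])
    qed
    have gs: "g q u v = (\<Sum>i\<in>UNIV. \<Sum>j\<in>UNIV. u $ i * v $ j * G i j q)" for q u v
      unfolding G_def by (rule bilinear_eq_sum_axis[OF bil])
    note DYi = bounded_linear.has_derivative[OF bounded_linear_vec_nth DY]
      and DZi = bounded_linear.has_derivative[OF bounded_linear_vec_nth DZ]
    have "((\<lambda>q. g q (Y q) (Z q)) has_derivative
        (\<lambda>w. \<Sum>i\<in>UNIV. \<Sum>j\<in>UNIV. Y p $ i * Z p $ j * DG i j w
           + (Y p $ i * DZ w $ j + DY w $ i * Z p $ j) * G i j p)) (at p)"
      unfolding gs
      by (rule has_derivative_sum has_derivative_mult DYi DZi DG)+
    then have "frechet_derivative (\<lambda>q. g q (Y q) (Z q)) (at p) (X p)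
      = (\<Sum>i\<in>UNIV. \<Sum>j\<in>UNIV. Y p $ i * Z p $ j * DG i j (X p)
           + (Y p $ i * DZ (X p) $ j + DY (X p) $ i * Z p $ j) * G i j p)"
      by (simp add: frechet_derivative_at[symmetric])
    also have "\<dots> = (\<Sum>i\<in>UNIV. \<Sum>j\<in>UNIV. Y p $ i * Z p $ j * DG i j (X p))
        + g p (Y p) (DZ (X p)) + g p (DY (X p)) (Z p)"
      unfolding gs[of p "Y p"] gs[of p "DY (X p)"] by (simp add: sum.distrib algebra_simps)
    also have "(\<Sum>i\<in>UNIV. \<Sum>j\<in>UNIV. Y p $ i * Z p $ j * DG i j (X p))
       = g p (\<Sum>k\<in>UNIV. \<Sum>i\<in>UNIV. (X p $ k * Y p $ i) *\<^sub>R \<Gamma> p k i) (Z p)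
       + g p (Y p) (\<Sum>k\<in>UNIV. \<Sum>j\<in>UNIV. (X p $ k * Z p $ j) *\<^sub>R \<Gamma> p k j)"
    proof -
      have l1: "linear (\<lambda>u. g p u v)" and l2: "linear (g p u)" for u v
        using bil by (simp_all add: bilinear_def)
      have rot: "(\<Sum>i\<in>UNIV. \<Sum>j\<in>UNIV. \<Sum>k\<in>UNIV. F i j k) = (\<Sum>k\<in>UNIV. \<Sum>i\<in>UNIV. \<Sum>j\<in>UNIV. F i j k)"
        for F :: "'a \<Rightarrow> 'a \<Rightarrow> 'a \<Rightarrow> real"
      proof -
        have "(\<Sum>i\<in>UNIV. \<Sum>j\<in>UNIV. \<Sum>k\<in>UNIV. F i j k) = (\<Sum>i\<in>UNIV. \<Sum>k\<in>UNIV. \<Sum>j\<in>UNIV. F i j k)"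
          by (intro sum.cong refl sum.swap)
        also have "\<dots> = (\<Sum>k\<in>UNIV. \<Sum>i\<in>UNIV. \<Sum>j\<in>UNIV. F i j k)" by (rule sum.swap)
        finally show ?thesis .
      qed
      have a: "g p u (Z p) = (\<Sum>j\<in>UNIV. Z p $ j * g p u (axis j 1))" for u
        by (subst vec_eq_sum_axis[of "Z p"]) (simp add: linear_sum[OF l2] linear_cmul[OF l2])
      have b: "g p (Y p) u = (\<Sum>i\<in>UNIV. Y p $ i * g p (axis i 1) u)" for u
        by (subst vec_eq_sum_axis[of "Y p"]) (simp add: linear_sum[OF l1] linear_cmul[OF l1])
      have "Y p $ i * Z p $ j * DG i j (X p)
        = (\<Sum>k\<in>UNIV. X p $ k * Y p $ i * (Z p $ j * g p (\<Gamma> p k i) (axis j 1)))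
        + (\<Sum>k\<in>UNIV. X p $ k * Z p $ j * (Y p $ i * g p (axis i 1) (\<Gamma> p k j)))" for i j
        unfolding lDG[of i j "X p"] using R
        by (simp add: DG_def G_def sum_distrib_left sum.distrib[symmetric] algebra_simps)
      then have "(\<Sum>i\<in>UNIV. \<Sum>j\<in>UNIV. Y p $ i * Z p $ j * DG i j (X p))
        = (\<Sum>i\<in>UNIV. \<Sum>j\<in>UNIV. \<Sum>k\<in>UNIV. X p $ k * Y p $ i * (Z p $ j * g p (\<Gamma> p k i) (axis j 1)))
        + (\<Sum>i\<in>UNIV. \<Sum>j\<in>UNIV. \<Sum>k\<in>UNIV. X p $ k * Z p $ j * (Y p $ i * g p (axis i 1) (\<Gamma> p k j)))"
        by (simp add: sum.distrib)
      also have "(\<Sum>i\<in>UNIV. \<Sum>j\<in>UNIV. \<Sum>k\<in>UNIV. X p $ k * Y p $ i * (Z p $ j * g p (\<Gamma> p k i) (axis j 1)))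
        = (\<Sum>k\<in>UNIV. \<Sum>i\<in>UNIV. \<Sum>j\<in>UNIV. X p $ k * Y p $ i * (Z p $ j * g p (\<Gamma> p k i) (axis j 1)))"
        by (rule rot)
      also have "\<dots> = g p (\<Sum>k\<in>UNIV. \<Sum>i\<in>UNIV. (X p $ k * Y p $ i) *\<^sub>R \<Gamma> p k i) (Z p)"
        by (simp only: linear_sum[OF l1] linear_cmul[OF l1] real_scaleR_def, simp add: a sum_distrib_left)
      also have "(\<Sum>i\<in>UNIV. \<Sum>j\<in>UNIV. \<Sum>k\<in>UNIV. X p $ k * Z p $ j * (Y p $ i * g p (axis i 1) (\<Gamma> p k j)))
        = (\<Sum>k\<in>UNIV. \<Sum>j\<in>UNIV. \<Sum>i\<in>UNIV. X p $ k * Z p $ j * (Y p $ i * g p (axis i 1) (\<Gamma> p k j)))"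
        by (subst sum.swap) (rule rot)
      also have "\<dots> = g p (Y p) (\<Sum>k\<in>UNIV. \<Sum>j\<in>UNIV. (X p $ k * Z p $ j) *\<^sub>R \<Gamma> p k j)"
        by (simp only: linear_sum[OF l2] linear_cmul[OF l2] real_scaleR_def, simp add: b sum_distrib_left)
      finally show ?thesis .
    qed
    finally show "frechet_derivative (\<lambda>q. g q (Y q) (Z q)) (at p) (X p)
        = g p (covariant_deriv \<Gamma> X Y p) (Z p) + g p (Y p) (covariant_deriv \<Gamma> X Z p)"
      unfolding covariant_deriv_def DY_def[symmetric] DZ_def[symmetric]
      by (simp add: bilinear_ladd[OF bil] bilinear_radd[OF bil])
  qed
qed

lemma ex1_levi_civita:
  assumes g: "pseudo_riemannian g"
  shows "\<exists>!\<Gamma>. torsion_free \<Gamma> \<and> metric_compatible g \<Gamma>"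
proof -
  have bil: "bilinear (g p)" and sym: "g p u v = g p v u" for p u v
    using g by (auto simp: pseudo_riemannian_def)
  have nd: "u = 0" if "\<And>k. g p u (axis k 1) = 0" for p u
  proof -
    have lin: "linear (g p u)" using bil by (simp add: bilinear_def)
    have "g p u v = 0" for v
      by (subst vec_eq_sum_axis[of v]) (simp add: linear_sum[OF lin] linear_cmul[OF lin] that)
    then show ?thesis using g unfolding pseudo_riemannian_def by blast
  qed
  define D where "D p k i j = frechet_derivative (\<lambda>q. g q (axis i 1) (axis j 1)) (at p) (axis k 1)" for p k i j
  have Dsym: "D p k i j = D p k j i" for p k i j
    by (simp add: D_def sym[of _ "axis i 1"])
  have ex: "\<exists>w. \<forall>k. g p w (axis k 1) = c k" for p and c :: "'a \<Rightarrow> real"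
  proof -
    define T where "T w = (\<chi> k. g p w (axis k 1))" for w
    have lin: "linear T"
      by (rule linearI) (simp_all add: T_def Finite_Cartesian_Product.vec_eq_iff bilinear_ladd[OF bil] bilinear_lmul[OF bil])
    have "inj T"
      unfolding linear_injective_0[OF lin] T_def Finite_Cartesian_Product.vec_eq_iff
      using nd by (metis vec_lambda_beta zero_index)
    then have "surj T" using lin by (intro linear_inj_imp_surj)
    then obtain w where "T w = (\<chi> k. c k)" by (metis surjD)
    then show ?thesis by (auto simp: T_def Finite_Cartesian_Product.vec_eq_iff)
  qed
  define \<Gamma> where "\<Gamma> p i j = (SOME w. \<forall>k. g p w (axis k 1) = (D p i j k + D p j i k - D p k i j) / 2)" for p i j
  have \<Gamma>: "g p (\<Gamma> p i j) (axis k 1) = (D p i j k + D p j i k - D p k i j) / 2" for p i j k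
    unfolding \<Gamma>_def by (rule someI_ex[OF ex, rule_format])
  have "\<Gamma> p i j = \<Gamma> p j i" for p i j
    unfolding \<Gamma>_def by (simp add: Dsym[of p _ i j] add.commute)
  then have 1: "torsion_free \<Gamma>" by (simp add: torsion_free_iff)
  have 2: "metric_compatible g \<Gamma>"
    unfolding metric_compatible_iff[OF g] D_def[symmetric]
  proof (intro allI)
    fix p i j k
    show "D p k i j = g p (\<Gamma> p k i) (axis j 1) + g p (axis i 1) (\<Gamma> p k j)"
      unfolding sym[of p "axis i 1"] \<Gamma> using Dsym[of p k i j] Dsym[of p i j k] Dsym[of p j i k] by (simp add: field_simps)
  qed
  have 3: "\<Gamma>' = \<Gamma>" if t: "torsion_free \<Gamma>'" and m: "metric_compatible g \<Gamma>'" for \<Gamma>'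
  proof (intro ext)
    fix p i j
    have m': "D p k i j = g p (\<Gamma>' p k i) (axis j 1) + g p (\<Gamma>' p k j) (axis i 1)" for i j k
      using m unfolding metric_compatible_iff[OF g] D_def[symmetric] by (metis sym)
    have t': "\<Gamma>' p i j = \<Gamma>' p j i" for i j using t by (simp add: torsion_free_iff)
    have "g p (\<Gamma>' p i j) (axis k 1) = g p (\<Gamma> p i j) (axis k 1)" for k
      unfolding \<Gamma> m' by (simp add: t'[of j i] t'[of k i] t'[of k j])
    then have "\<Gamma>' p i j - \<Gamma> p i j = 0"
      by (intro nd) (simp add: bilinear_lsub[OF bil])
    then show "\<Gamma>' p i j = \<Gamma> p i j" by simp
  qed
  show ?thesis using 1 2 3 by blast
qed

lemma levi_civita_eqI:
  assumes "pseudo_riemannian g" "torsion_free \<Gamma>" "metric_compatible g \<Gamma>"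
  shows "levi_civita g = \<Gamma>"
  unfolding levi_civita_def by (rule the1_equality[OF ex1_levi_civita]) (use assms in auto)

end

theory Submission
  imports Defs "Jordan_Normal_Form.Jordan_Normal_Form_Uniqueness"
begin

no_notation Matrix.vec_index (infixl "$" 100)

text \<open>
  Write \<open>P v\<close> for the image of \<open>v\<close> under the para-complex structure that fixes the horizontal lifts and
  negates the fibre directions. There are a null vector \<open>\<phi>\<close> and a vector \<open>Z\<close>, depending on \<open>v\<close>, with
  \<open>J(v) y = 1/4 g(v,v) y - 1/4 g(v,y) v - 3/4 g(P v,y) P v + g(\<phi>,y) Z + g(Z,y) \<phi>\<close>,
  and all inner products among \<open>v\<close>, \<open>P v\<close>, \<open>\<phi>\<close>, \<open>Z\<close> vanish except \<open>g(v,v) = -g(P v,P v)\<close> and possibly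
  \<open>g(P v,Z)\<close> and \<open>g(Z,Z)\<close>. So the characteristic polynomial is that of a space form of constant
  para-holomorphic curvature, for which \<open>\<phi> = 0\<close>. Whenever the first coordinate of \<open>v\<close> is non-zero, \<open>\<phi>\<close> is
  the end of a Jordan chain of length at least two for the eigenvalue \<open>g(v,v)/4\<close>, while \<open>\<phi> = 0\<close> and \<open>J(v)\<close>
  is diagonalizable for non-null \<open>v\<close> over \<open>\<partial>\<^sub>3\<close>.
\<close>

section \<open>Matrices of endomorphisms and determinants of rank-one perturbations\<close>

lemma complex_matrix_carrier [simp]:
  "complex_matrix (f :: real ^ ('n::enum) \<Rightarrow> real ^ ('n::enum)) \<in> carrier_mat CARD('n::enum) CARD('n)"
  by (simp add: complex_matrix_def)

lemma complex_matrix_index: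
  assumes "r < CARD('n)" "s < CARD('n)"
  shows "complex_matrix (f :: real ^ ('n::enum) \<Rightarrow> real ^ ('n::enum)) $$ (r, s)
    = complex_of_real (f (axis (Enum.enum ! s) 1) $ (Enum.enum ! r))"
  using assms by (simp add: complex_matrix_def)

lemma dim_complex_matrix [simp]:
  "dim_row (complex_matrix (f :: real ^ ('n::enum) \<Rightarrow> real ^ ('n::enum))) = CARD('n::enum)"
  "dim_col (complex_matrix (f :: real ^ ('n::enum) \<Rightarrow> real ^ ('n::enum))) = CARD('n::enum)"
  by (simp_all add: complex_matrix_def)

lemma bij_betw_nth_enum: "bij_betw ((!) Enum.enum) {0..<CARD('n)} (UNIV :: 'n::enum set)"
  by (rule bij_betw_nth) (auto simp: enum_distinct enum_UNIV card_UNIV_length_enum)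

lemma sum_nth_enum: "(\<Sum>k = 0..<CARD('n). h (Enum.enum ! k)) = (\<Sum>i\<in>(UNIV :: 'n::enum set). h i)"
  by (rule sum.reindex_bij_betw[OF bij_betw_nth_enum])

lemma nth_enum_eq_iff:
  assumes "r < CARD('n)" "s < CARD('n)"
  shows "(Enum.enum ! r :: 'n::enum) = Enum.enum ! s \<longleftrightarrow> r = s"
  using assms by (simp add: nth_eq_iff_index_eq enum_distinct card_UNIV_length_enum)

lemma linear_nth_sum_axis:
  fixes f :: "real ^ ('n::enum) \<Rightarrow> real ^ ('n::enum)"
  assumes "linear f"
  shows "f x $ r = (\<Sum>i\<in>UNIV. f (axis i 1) $ r * x $ i)"
proof -
  have "f x = f (\<Sum>i\<in>UNIV. x $ i *\<^sub>R axis i 1)"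
    using vec_eq_sum_axis by metis
  then show ?thesis
    by (simp add: linear_sum[OF assms] linear_cmul[OF assms] mult.commute)
qed

lemma complex_matrix_comp:
  fixes f g :: "real ^ ('n::enum) \<Rightarrow> real ^ ('n::enum)"
  assumes "linear f"
  shows "complex_matrix (\<lambda>x. f (g x)) = complex_matrix f * complex_matrix g"
proof (rule eq_matI)
  fix r s assume "r < dim_row (complex_matrix f * complex_matrix g)"
    "s < dim_col (complex_matrix f * complex_matrix g)"
  then have rs: "r < CARD('n)" "s < CARD('n)" by simp_all
  let ?h = "\<lambda>i. complex_of_real (f (axis i 1) $ (Enum.enum ! r) * g (axis (Enum.enum ! s) 1) $ i)"
  have "(complex_matrix f * complex_matrix g) $$ (r, s) = (\<Sum>k = 0..<CARD('n). ?h (Enum.enum ! k))"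
    using rs by (simp add: scalar_prod_def complex_matrix_index)
  also have "\<dots> = (\<Sum>i\<in>UNIV. ?h i)" by (rule sum_nth_enum)
  also have "\<dots> = complex_matrix (\<lambda>x. f (g x)) $$ (r, s)"
    using rs by (simp only: complex_matrix_index linear_nth_sum_axis[OF assms, of "g _"] of_real_sum)
  finally show "complex_matrix (\<lambda>x. f (g x)) $$ (r, s) = (complex_matrix f * complex_matrix g) $$ (r, s)"
    by simp
qed simp_all

lemma complex_matrix_scaleR:
  "complex_matrix (\<lambda>x :: real ^ ('n::enum). c *\<^sub>R x) = complex_of_real c \<cdot>\<^sub>m 1\<^sub>m CARD('n::enum)"
  by (rule eq_matI) (auto simp: complex_matrix_index axis_def nth_enum_eq_iff)

text \<open>Sylvester's determinant identity in rank one. One bordered block matrix factors both as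
  \<open>A * B\<close> and as \<open>B * C\<close> with \<open>det B = 1\<close>, so the block
  triangular matrices \<open>A\<close> and \<open>C\<close> have equal determinants.\<close>

lemma det_one_add_rank_one:
  fixes U W :: "'a::idom mat"
  assumes U: "U \<in> carrier_mat n 1" and W: "W \<in> carrier_mat 1 n"
  shows "det (1\<^sub>m n + U * W) = 1 + (W * U) $$ (0, 0)"
proof -
  have c: "1\<^sub>m n + U * W \<in> carrier_mat n n" "1\<^sub>m 1 + W * U \<in> carrier_mat 1 1" "- U \<in> carrier_mat n 1"
    using U W by auto
  define A where "A = four_block_mat (1\<^sub>m n + U * W) (- U) (0\<^sub>m 1 n) (1\<^sub>m 1)"
  define B where "B = four_block_mat (1\<^sub>m n) (0\<^sub>m n 1) W (1\<^sub>m 1)"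
  define C where "C = four_block_mat (1\<^sub>m n) (- U) (0\<^sub>m 1 n) (1\<^sub>m 1 + W * U)"
  have "A * B = four_block_mat (1\<^sub>m n) (- U) W (1\<^sub>m 1)"
    unfolding A_def B_def
    by (subst mult_four_block_mat[of _ n n _ 1 _ 1 _ _ n _ 1])
      (use U W c in \<open>auto intro!: cong_four_block_mat eq_matI simp: scalar_prod_def\<close>)
  also have "\<dots> = B * C"
    unfolding B_def C_def
    by (subst mult_four_block_mat[of _ n n _ 1 _ 1 _ _ n _ 1])
      (use U W c in \<open>auto intro!: cong_four_block_mat eq_matI simp: scalar_prod_def sum_negf\<close>)
  finally have "det (A * B) = det (B * C)" by simp
  moreover have "det A = det (1\<^sub>m n + U * W)"
    using c U W unfolding A_def by (subst det_four_block_mat_lower_left_zero[of _ n _ 1]) auto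
  moreover have "det C = det (1\<^sub>m 1 + W * U)"
    using c U W unfolding C_def by (subst det_four_block_mat_lower_left_zero[of _ n _ 1]) auto
  moreover have "det B = 1"
    using c U W unfolding B_def by (subst det_four_block_mat_upper_right_zero[of _ n _ 1]) auto
  moreover have "det (1\<^sub>m 1 + W * U) = 1 + (W * U) $$ (0, 0)"
    using c U W by (subst det_single) auto
  moreover have "A \<in> carrier_mat (n + 1) (n + 1)" "B \<in> carrier_mat (n + 1) (n + 1)" "C \<in> carrier_mat (n + 1) (n + 1)"
    using c U W unfolding A_def B_def C_def by (auto intro!: four_block_carrier_mat)
  ultimately show ?thesis
    by (metis det_mult mult.right_neutral mult_1)
qed

lemma det_complex_matrix_rank_one:
  fixes u :: "real ^ ('n::enum)"
  assumes L: "linear L"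
  shows "det (complex_matrix (\<lambda>x. x + L x *\<^sub>R u)) = complex_of_real (1 + L u)"
proof -
  define U where "U = Matrix.mat CARD('n) 1 (\<lambda>(r, _). complex_of_real (u $ (Enum.enum ! r)))"
  define W where "W = Matrix.mat 1 CARD('n) (\<lambda>(_, s). complex_of_real (L (axis (Enum.enum ! s :: 'n) 1)))"
  have "complex_matrix (\<lambda>x. x + L x *\<^sub>R u) = 1\<^sub>m CARD('n) + U * W"
    by (rule eq_matI)
      (auto simp: U_def W_def complex_matrix_index axis_def nth_enum_eq_iff scalar_prod_def)
  moreover have "(W * U) $$ (0, 0) = complex_of_real (L u)"
  proof -
    have "(W * U) $$ (0, 0) = (\<Sum>k = 0..<CARD('n). (\<lambda>i. complex_of_real (L (axis i 1) * u $ i)) (Enum.enum ! k))"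
      by (simp add: U_def W_def scalar_prod_def)
    also have "\<dots> = complex_of_real (\<Sum>i\<in>UNIV. L (axis i 1) * u $ i)"
      by (subst sum_nth_enum) (simp only: of_real_sum)
    also have "(\<Sum>i\<in>UNIV. L (axis i 1) * u $ i) = L (\<Sum>i\<in>UNIV. u $ i *\<^sub>R axis i 1)"
      by (simp add: linear_sum[OF L] linear_cmul[OF L] mult.commute)
    finally show ?thesis by (simp flip: vec_eq_sum_axis)
  qed
  moreover have "det (1\<^sub>m CARD('n) + U * W) = 1 + (W * U) $$ (0, 0)"
    by (rule det_one_add_rank_one) (simp_all add: U_def W_def)
  ultimately show ?thesis by simp
qed

section \<open>Characteristic polynomials from real evaluation points\<close>

lemma poly_char_poly_complex_matrix:
  fixes f :: "real ^ ('n::enum) \<Rightarrow> real ^ ('n::enum)"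
  shows "poly (char_poly (complex_matrix f)) (complex_of_real c) = det (complex_matrix (\<lambda>x. c *\<^sub>R x - f x))"
proof -
  have "complex_matrix (\<lambda>x. c *\<^sub>R x - f x) = - char_matrix (complex_matrix f) (complex_of_real c)"
    by (rule eq_matI) (auto simp: char_matrix_def complex_matrix_index axis_def nth_enum_eq_iff)
  then show ?thesis
    by (simp add: char_poly_matrix[OF complex_matrix_carrier])
qed

text \<open>A non-zero difference would have only finitely many roots, but infinitely many reals lie
  outside \<open>S\<close>. The set \<open>S\<close> leaves room for points at which a computation
  has to divide by zero.\<close>

lemma complex_poly_eqI_real:
  fixes p q :: "complex poly"
  assumes "finite S" "\<And>x::real. x \<notin> S \<Longrightarrow> poly p (complex_of_real x) = poly q (complex_of_real x)"
  shows "p = q"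
proof (rule ccontr)
  assume "p \<noteq> q"
  then have "finite {z. poly (p - q) z = 0}" by (intro poly_roots_finite) simp
  moreover have "complex_of_real ` (- S) \<subseteq> {z. poly (p - q) z = 0}" using assms(2) by auto
  ultimately have "finite (- S)"
    by (metis finite_imageD finite_subset inj_of_real inj_on_subset subset_UNIV)
  then show False
    using assms(1) infinite_UNIV_char_0[where 'a = real] by (metis Compl_partition finite_UnI)
qed

text \<open>For real \<open>c\<close> other than \<open>s * q / 4\<close>, the map
  \<open>c - s f\<close> is a non-zero multiple of a composition of four rank-one perturbations of
  the identity, whose determinants multiply. The two factors built from \<open>\<phi>\<close> and
  \<open>Z\<close> have determinant 1 because \<open>B \<phi> Z = 0\<close>; those of
  \<open>v\<close> and \<open>P\<close> produce the roots 0 and \<open>s * q\<close>.\<close>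

lemma char_poly_rank_one_perturbation:
  fixes B :: "real ^ ('n::enum) \<Rightarrow> real ^ ('n::enum) \<Rightarrow> real" and q s :: real
  assumes B: "bilinear B" "\<And>x y. B x y = B y x"
    and v: "B v v = q" and P: "B P P = - q"
    and orth: "B v P = 0" "B v \<phi> = 0" "B v Z = 0" "B P \<phi> = 0" "B \<phi> \<phi> = 0" "B \<phi> Z = 0"
    and f: "\<And>y. f y = (q/4) *\<^sub>R y - (B v y / 4) *\<^sub>R v - (3/4 * B P y) *\<^sub>R P
        + B \<phi> y *\<^sub>R Z + B Z y *\<^sub>R \<phi>"
    and card: "CARD('n) \<ge> 2"
  shows "char_poly (complex_matrix (\<lambda>y. s *\<^sub>R f y))
    = [:0, 1:] * [:- complex_of_real (s * q), 1:] * [:- complex_of_real (s * q / 4), 1:] ^ (CARD('n) - 2)"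
proof (rule complex_poly_eqI_real[of "{s * q / 4}"])
  fix c :: real assume "c \<notin> {s * q / 4}"
  define \<mu> where "\<mu> = c - s * q / 4"
  have \<mu>: "\<mu> \<noteq> 0" using \<open>c \<notin> _\<close> by (simp add: \<mu>_def)
  note lin [simp] = bilinear_ladd[OF B(1)] bilinear_radd[OF B(1)] bilinear_lmul[OF B(1)] bilinear_rmul[OF B(1)]
  have linB: "linear (\<lambda>y. k * B w y)" for k w
    by (rule linearI) (simp_all add: algebra_simps)
  define F where "F k w u = (\<lambda>y. y + (k * B w y) *\<^sub>R u)" for k w u
  have linF: "linear (F k w u)" for k w u
    by (rule linearI) (simp_all add: F_def algebra_simps)
  have detF: "det (complex_matrix (F k w u)) = complex_of_real (1 + k * B w u)" for k w u
    unfolding F_def by (rule det_complex_matrix_rank_one[OF linB])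
  text \<open>
    In this order of the factors the cross terms of the product \<open>F1 F2 F3 F4\<close> vanish, although
    \<open>B P Z\<close> and \<open>B Z Z\<close> may be non-zero.
  \<close>
  define F1 where "F1 = F (s / (4 * \<mu>)) v v"
  define F2 where "F2 = F (- s / \<mu>) \<phi> Z"
  define F3 where "F3 = F (3 * s / (4 * \<mu>)) P P"
  define F4 where "F4 = F (- s / \<mu>) Z \<phi>"
  have "B \<phi> P = 0" "B Z \<phi> = 0"
    using orth B(2)[of \<phi> P] B(2)[of Z \<phi>] by simp_all
  note orth' = orth this
  have f34: "F3 (F4 y) = y + (3 * s / (4 * \<mu>) * B P y) *\<^sub>R P - (s / \<mu> * B Z y) *\<^sub>R \<phi>" for y
    by (simp add: F3_def F4_def F_def orth' bilinear_rsub[OF B(1)])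
  have f24: "F2 (F3 (F4 y)) = y + (3 * s / (4 * \<mu>) * B P y) *\<^sub>R P - (s / \<mu> * B Z y) *\<^sub>R \<phi>
      - (s / \<mu> * B \<phi> y) *\<^sub>R Z" for y
    unfolding f34 by (simp add: F2_def F_def orth' bilinear_rsub[OF B(1)])
  have f14: "F1 (F2 (F3 (F4 y))) = y + (3 * s / (4 * \<mu>) * B P y) *\<^sub>R P - (s / \<mu> * B Z y) *\<^sub>R \<phi>
      - (s / \<mu> * B \<phi> y) *\<^sub>R Z + (s / (4 * \<mu>) * B v y) *\<^sub>R v" for y
    unfolding f24 by (simp add: F1_def F_def orth' bilinear_rsub[OF B(1)])
  have "c *\<^sub>R y - s *\<^sub>R f y = \<mu> *\<^sub>R F1 (F2 (F3 (F4 y)))" for y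
  proof -
    have c: "c = \<mu> + s * q / 4" by (simp add: \<mu>_def)
    show ?thesis
      unfolding f14 f c Finite_Cartesian_Product.vec_eq_iff
      using \<mu> by (auto simp: field_simps)
  qed
  then have "poly (char_poly (complex_matrix (\<lambda>y. s *\<^sub>R f y))) (complex_of_real c)
      = det (complex_matrix (\<lambda>y. \<mu> *\<^sub>R F1 (F2 (F3 (F4 y)))))"
    by (simp add: poly_char_poly_complex_matrix)
  also have "\<dots> = det (complex_of_real \<mu> \<cdot>\<^sub>m 1\<^sub>m CARD('n) * (complex_matrix F1
      * (complex_matrix F2 * (complex_matrix F3 * complex_matrix F4))))"
    using complex_matrix_comp[of "\<lambda>y. \<mu> *\<^sub>R y" "\<lambda>y. F1 (F2 (F3 (F4 y)))"]
      complex_matrix_comp[of F1 "\<lambda>y. F2 (F3 (F4 y))"] complex_matrix_comp[of F2 "\<lambda>y. F3 (F4 y)"]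
      complex_matrix_comp[of F3 F4] linF
    by (simp add: F1_def F2_def F3_def complex_matrix_scaleR linear_compose_scale_right linear_ident)
  also have "\<dots> = complex_of_real \<mu> ^ CARD('n) * (det (complex_matrix F1) * (det (complex_matrix F2)
      * (det (complex_matrix F3) * det (complex_matrix F4))))"
    by (simp add: det_mult[of _ "CARD('n)"] det_smult mult_carrier_mat[of _ "CARD('n)" "CARD('n)"])
  also have "\<dots> = complex_of_real (\<mu> ^ CARD('n) * ((1 + s * q / (4 * \<mu>)) * (1 - 3 * s * q / (4 * \<mu>))))"
    by (simp add: F1_def F2_def F3_def F4_def detF v P orth')
  also have "\<mu> ^ CARD('n) * ((1 + s * q / (4 * \<mu>)) * (1 - 3 * s * q / (4 * \<mu>)))
      = c * (c - s * q) * \<mu> ^ (CARD('n) - 2)"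
  proof -
    \<comment> \<open>Two powers of \<open>\<mu>\<close> are split off to clear the denominators of
      the two brackets; \<open>card\<close> keeps the natural subtraction from truncating.\<close>
    have pow: "\<mu> ^ CARD('n) = \<mu> ^ (CARD('n) - 2) * \<mu> * \<mu>"
      using card by (metis le_add_diff_inverse2 mult.assoc power2_eq_square power_add)
    have "\<mu> * (1 + s * q / (4 * \<mu>)) = \<mu> + s * q / 4" "\<mu> * (1 - 3 * s * q / (4 * \<mu>)) = \<mu> - 3 * s * q / 4"
      unfolding distrib_left right_diff_distrib using \<mu> by simp_all
    then have e: "\<mu> * (1 + s * q / (4 * \<mu>)) = c" "\<mu> * (1 - 3 * s * q / (4 * \<mu>)) = c - s * q"
      by (simp_all add: \<mu>_def)
    have "\<mu> ^ CARD('n) * ((1 + s * q / (4 * \<mu>)) * (1 - 3 * s * q / (4 * \<mu>)))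
        = (\<mu> * (1 + s * q / (4 * \<mu>))) * (\<mu> * (1 - 3 * s * q / (4 * \<mu>))) * \<mu> ^ (CARD('n) - 2)"
      unfolding pow by (simp only: mult_ac)
    then show ?thesis unfolding e .
  qed
  finally show "poly (char_poly (complex_matrix (\<lambda>y. s *\<^sub>R f y))) (complex_of_real c)
      = poly ([:0, 1:] * [:- complex_of_real (s * q), 1:] * [:- complex_of_real (s * q / 4), 1:] ^ (CARD('n) - 2))
          (complex_of_real c)"
    by (simp add: poly_power \<mu>_def algebra_simps)
qed simp

section \<open>Diagonalizability and similarity\<close>

text \<open>In an eigenbasis, \<open>f - c\<close> multiplies each coefficient by
  \<open>a b - c\<close>. If doing so twice gives zero, then so does doing it once, hence there is
  no Jordan chain of length two.\<close>

lemma diagonalizable_double_kernel: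
  fixes f :: "real ^ 'n \<Rightarrow> real ^ 'n"
  assumes f: "linear f" and d: "diagonalizable f"
    and x: "f (f x - c *\<^sub>R x) = c *\<^sub>R (f x - c *\<^sub>R x)"
  shows "f x = c *\<^sub>R x"
proof -
  obtain B where B: "independent B" "span B = UNIV" and ev: "\<forall>b\<in>B. \<exists>a::real. f b = a *\<^sub>R b"
    using d unfolding diagonalizable_def by blast
  from bchoice[OF ev] obtain a where a: "\<And>b. b \<in> B \<Longrightarrow> f b = a b *\<^sub>R b"
    by blast
  have fin: "finite B" using B(1) by (rule independent_imp_finite)
  have "x \<in> range (\<lambda>r. \<Sum>b\<in>B. r b *\<^sub>R b)"
    unfolding span_finite[OF fin, symmetric] B(2) by simp
  then obtain r where r: "x = (\<Sum>b\<in>B. r b *\<^sub>R b)" by blast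
  have h: "f (\<Sum>b\<in>B. k b *\<^sub>R b) - c *\<^sub>R (\<Sum>b\<in>B. k b *\<^sub>R b) = (\<Sum>b\<in>B. (k b * (a b - c)) *\<^sub>R b)" for k
    by (simp add: linear_sum[OF f] linear_cmul[OF f] a scaleR_sum_right sum_subtractf[symmetric] algebra_simps)
  have "(\<Sum>b\<in>B. (r b * (a b - c) * (a b - c)) *\<^sub>R b) = 0"
    using x unfolding h[symmetric] r by simp
  then have "\<forall>b\<in>B. r b * (a b - c) * (a b - c) = 0"
    using B(1) independentD[OF B(1) fin order_refl, of "\<lambda>b. r b * (a b - c) * (a b - c)"] by blast
  then have "f x - c *\<^sub>R x = 0"
    unfolding r h by (intro sum.neutral) auto
  then show ?thesis by simp
qed

text \<open>The inner \<open>Q * P\<close> cancels. Sharing the witnesses \<open>P\<close> and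
  \<open>Q\<close> is essential, since similarity alone is not compatible with products.\<close>

lemma similar_mat_wit_mult:
  fixes A B A' B' :: "'a::comm_ring_1 mat"
  assumes "similar_mat_wit A B P Q" "similar_mat_wit A' B' P Q" "A \<in> carrier_mat n n" "A' \<in> carrier_mat n n"
  shows "similar_mat_wit (A * A') (B * B') P Q"
proof -
  note 1 = similar_mat_witD2[OF assms(3,1)] and 2 = similar_mat_witD2[OF assms(4,2)]
  note c = 1(5-) 2(5)
  have "A * A' = (P * B * Q) * (P * B' * Q)" using 1(3) 2(3) by simp
  also have "\<dots> = P * B * (Q * P) * B' * Q"
    using c by (simp add: assoc_mult_mat[of _ n n _ n _ n])
  also have "\<dots> = P * (B * B') * Q"
    using c 1(2) by (simp add: assoc_mult_mat[of _ n n _ n _ n])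
  finally show ?thesis
    using c 1 2 by (intro similar_mat_witI[of _ _ n]) auto
qed

text \<open>A common Jordan form makes the two matrices similar, and the same change of basis
  conjugates every shift by a scalar. An annihilating polynomial with real roots \<open>a\<close>,
  \<open>b\<close>, \<open>c\<close> therefore passes from \<open>f\<close> to
  \<open>h\<close>.\<close>

lemma jordan_nf_annihilator:
  fixes f h :: "real ^ ('n::enum) \<Rightarrow> real ^ ('n::enum)"
  assumes f: "linear f" and h: "linear h"
    and J: "jordan_nf (complex_matrix f) J" "jordan_nf (complex_matrix h) J"
  defines "T \<equiv> \<lambda>k c x. k x - c *\<^sub>R x"
  assumes 0: "\<And>x. T f a (T f b (T f c x)) = 0"
  shows "T h a (T h b (T h c x)) = 0"
proof -
  have linT: "linear (T k c)" if "linear k" for k :: "real ^ ('n::enum) \<Rightarrow> real ^ ('n::enum)" and c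
    using that unfolding T_def by (intro linear_compose_sub linear_compose_scale_right) (auto simp: linear_ident)
  let ?p = "\<lambda>k. complex_matrix (T k a) * (complex_matrix (T k b) * complex_matrix (T k c))"
  have p: "complex_matrix (\<lambda>x. T k a (T k b (T k c x))) = ?p k" if "linear k" for k :: "real ^ ('n::enum) \<Rightarrow> real ^ ('n::enum)"
    using complex_matrix_comp[OF linT[OF that], of a "\<lambda>x. T k b (T k c x)"]
      complex_matrix_comp[OF linT[OF that], of b "T k c"] by simp
  have "similar_mat (complex_matrix h) (complex_matrix f)"
    using J unfolding jordan_nf_def using similar_mat_sym similar_mat_trans by blast
  then obtain P Q where PQ: "similar_mat_wit (complex_matrix h) (complex_matrix f) P Q"
    unfolding similar_mat_def by blast
  have T: "complex_matrix (T k c) = char_matrix (complex_matrix k) (complex_of_real c)"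
    for k :: "real ^ ('n::enum) \<Rightarrow> real ^ ('n::enum)" and c
    by (rule eq_matI) (auto simp: T_def char_matrix_def complex_matrix_index axis_def nth_enum_eq_iff)
  have "similar_mat_wit (complex_matrix (T h c)) (complex_matrix (T f c)) P Q" for c
    unfolding T by (rule similar_mat_wit_char_matrix[OF PQ])
  then have "similar_mat_wit (?p h) (?p f) P Q"
    by (intro similar_mat_wit_mult[of _ _ _ _ _ _ "CARD('n)"]) (auto intro!: mult_carrier_mat)
  moreover have "?p f = 0\<^sub>m CARD('n) CARD('n)"
    unfolding p[OF f, symmetric] 0 by (rule eq_matI) (auto simp: complex_matrix_index)
  moreover have c: "?p h \<in> carrier_mat CARD('n) CARD('n)"
    by (auto intro!: mult_carrier_mat)
  ultimately have "?p h = 0\<^sub>m CARD('n) CARD('n)"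
    using similar_mat_witD2[OF c] by (metis left_mult_zero_mat right_mult_zero_mat)
  then have z: "complex_matrix (\<lambda>x. T h a (T h b (T h c x))) = 0\<^sub>m CARD('n) CARD('n)"
    by (simp add: p[OF h])
  have "T h a (T h b (T h c (axis i 1))) $ j = 0" for i j
  proof -
    obtain r s where "r < CARD('n)" "s < CARD('n)" "i = Enum.enum ! s" "j = Enum.enum ! r"
      by (metis UNIV_I card_UNIV_length_enum enum_UNIV in_set_conv_nth)
    then show ?thesis
      using complex_matrix_index[of r s "\<lambda>x. T h a (T h b (T h c x))"] z by simp
  qed
  moreover have "linear (\<lambda>x. T h a (T h b (T h c x)))"
    using linear_compose[OF linear_compose[OF linT linT] linT, OF h h h, of a b c] by (simp add: o_def)
  ultimately have "T h a (T h b (T h c x)) $ j = 0" for j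
    using linear_nth_sum_axis[of "\<lambda>x. T h a (T h b (T h c x))" x j] by simp
  then show ?thesis
    by (simp add: Finite_Cartesian_Product.vec_eq_iff)
qed

section \<open>The metric\<close>

lemma times_differentiable_const [simp]: "times_differentiable k (\<lambda>_. c)"
  by (induction k arbitrary: c) simp_all

lemma times_differentiable_Suc_D: "times_differentiable (Suc k) f \<Longrightarrow> times_differentiable k f"
  by (induction k arbitrary: f) auto

lemma times_differentiable_add:
  "times_differentiable k f \<Longrightarrow> times_differentiable k h \<Longrightarrow> times_differentiable k (\<lambda>p. f p + h p)"
proof (induction k arbitrary: f h)
  case (Suc k)
  then have d: "f differentiable (at p)" "h differentiable (at p)" for p
    by (simp_all add: differentiable_on_def)
  have D: "((\<lambda>p. f p + h p) has_derivative
      (\<lambda>v. frechet_derivative f (at p) v + frechet_derivative h (at p) v)) (at p)" for p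
    using d frechet_derivative_works by (intro has_derivative_add) auto
  have "frechet_derivative (\<lambda>p. f p + h p) (at p) v
      = frechet_derivative f (at p) v + frechet_derivative h (at p) v" for p v
    by (simp add: frechet_derivative_at[OF D, symmetric])
  then show ?case
    using Suc by (auto intro!: differentiable_on_add)
qed simp

lemma times_differentiable_mult:
  "times_differentiable k f \<Longrightarrow> times_differentiable k h \<Longrightarrow> times_differentiable k (\<lambda>p. f p * h p)"
proof (induction k arbitrary: f h)
  case (Suc k)
  then have d: "f differentiable (at p)" "h differentiable (at p)" for p
    by (simp_all add: differentiable_on_def)
  have D: "((\<lambda>p. f p * h p) has_derivative
      (\<lambda>v. f p * frechet_derivative h (at p) v + frechet_derivative f (at p) v * h p)) (at p)" for p
    using d frechet_derivative_works by (intro has_derivative_mult) auto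
  have "frechet_derivative (\<lambda>p. f p * h p) (at p) v
      = f p * frechet_derivative h (at p) v + frechet_derivative f (at p) v * h p" for p v
    by (simp add: frechet_derivative_at[OF D, symmetric])
  then show ?case
    \<comment> \<open>The product rule leaves one factor undifferentiated, so the induction
      hypothesis also needs \<open>f\<close> and \<open>h\<close> themselves at order
      \<open>k\<close>.\<close>
    using Suc times_differentiable_Suc_D[OF Suc.prems(1)] times_differentiable_Suc_D[OF Suc.prems(2)]
    by (auto intro!: differentiable_on_mult times_differentiable_add)
qed simp

lemma times_differentiable_linear:
  fixes f :: "real ^ 'n \<Rightarrow> real"
  assumes "linear f"
  shows "times_differentiable k f"
proof (cases k)
  case (Suc l)
  have "(f has_derivative f) (at p)" for p
    using assms by (simp add: linear_imp_has_derivative)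
  then have "f differentiable_on UNIV" "frechet_derivative f (at p) = f" for p
    by (auto simp: differentiable_on_def differentiable_def frechet_derivative_at[symmetric])
  then show ?thesis by (simp add: Suc)
qed simp

text \<open>
  For \<open>v\<close> tangent at \<open>p\<close>, \<open>pairing v p\<close> is the tautological one-form at \<open>p\<close> evaluated at \<open>v\<close>.
\<close>
definition pairing :: "real ^ (3 + 3) \<Rightarrow> real ^ (3 + 3) \<Rightarrow> real" where
  "pairing u v = u $ Inl 1 * v $ Inr 1 + u $ Inl 2 * v $ Inr 2 + u $ Inl 3 * v $ Inr 3"

definition cotangent_vector :: "real ^ 3 \<Rightarrow> real ^ 3 \<Rightarrow> real ^ (3 + 3)" where
  "cotangent_vector a b = (\<chi> i. case i of Inl j \<Rightarrow> a $ j | Inr j \<Rightarrow> b $ j)"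

lemma cotangent_vector_nth [simp]:
  "cotangent_vector a b $ Inl j = a $ j" "cotangent_vector a b $ Inr j = b $ j"
  by (simp_all add: cotangent_vector_def)

lemma vec33_eq_iff:
  fixes u v :: "real ^ (3 + 3)"
  shows "u = v \<longleftrightarrow> (\<forall>k. u $ Inl k = v $ Inl k) \<and> (\<forall>k. u $ Inr k = v $ Inr k)"
  by (simp add: Finite_Cartesian_Product.vec_eq_iff split_sum_all)

abbreviation mre :: "(3 + 3) metric_field" where
  "mre \<equiv> modified_riemannian_extension 1 nabla"

text \<open>The coefficients \<open>x_i' x_j'\<close> factor, so their contribution is the square of
  the tautological one-form. The last summand comes from the single Christoffel symbol.\<close>

lemma mre_eq:
  "mre p u v = pairing u v + pairing v u + pairing u p * pairing v p
    - 2 * p $ Inl 2 * p $ Inr 3 * u $ Inl 1 * v $ Inl 1"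
  by (simp add: modified_riemannian_extension_def sym_product_def nabla_def base_point_def
      pairing_def sum_3 axis_def field_simps)

lemma pairing_linear: "linear (\<lambda>u. pairing u v)" "linear (pairing u)"
  by (rule linearI; simp add: pairing_def algebra_simps)+

lemma pairing_simps [simp]:
  "pairing (u + u') v = pairing u v + pairing u' v" "pairing u (v + v') = pairing u v + pairing u v'"
  "pairing (c *\<^sub>R u) v = c * pairing u v" "pairing u (c *\<^sub>R v) = c * pairing u v"
  by (simp_all add: pairing_def algebra_simps)

lemma bilinear_mre: "bilinear (mre p)"
  unfolding bilinear_def
  by (intro conjI allI linearI) (simp_all add: mre_eq algebra_simps)

lemma mre_sym: "mre p u v = mre p v u"
  by (simp add: mre_eq)

lemma pairing_axis [simp]:
  "pairing u (axis (Inr k) 1) = u $ Inl k" "pairing (axis (Inr k) 1) u = 0"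
  "pairing u (axis (Inl k) 1) = 0" "pairing (axis (Inl k) 1) u = u $ Inr k"
  using exhaust_3[of k] by (auto simp: pairing_def axis_def)

lemma axis_Inr_nth_Inl [simp]: "axis (Inr k) c $ Inl j = 0"
  by (simp add: axis_def)

lemma pseudo_riemannian_mre: "pseudo_riemannian mre"
  unfolding pseudo_riemannian_def
proof (intro conjI allI impI bilinear_mre mre_sym)
  fix u v :: "real ^ (3 + 3)"
  have eq: "mre p u v = (pairing u v + pairing v u) + (pairing u p * pairing v p
      + - 2 * u $ Inl 1 * v $ Inl 1 * (p $ Inl 2 * p $ Inr 3))" for p
    by (simp add: mre_eq)
  have nth: "linear (\<lambda>p :: real ^ (3 + 3). p $ i)" for i
    by (rule linearI) simp_all
  show "smooth (\<lambda>p. mre p u v)"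
    unfolding smooth_def eq
    by (intro allI times_differentiable_add times_differentiable_mult times_differentiable_const
        times_differentiable_linear pairing_linear nth)
next
  fix p u assume u: "\<forall>v. mre p u v = 0"
  \<comment> \<open>Testing against fibre directions isolates the base components of
    \<open>u\<close>; once these vanish, base directions isolate the fibre components.\<close>
  have l: "u $ Inl k = 0" for k
    using u[rule_format, of "axis (Inr k) 1"] by (simp add: mre_eq)
  then have "u $ Inr k = 0" for k
    using u[rule_format, of "axis (Inl k) 1"] by (simp add: mre_eq pairing_def[of u])
  with l show "u = 0" by (simp add: vec33_eq_iff)
qed

text \<open>
  The vectors \<open>adapted_vector p a 0\<close> span a null complement of the fibre directions.
\<close>
definition adapted_vector :: "real ^ (3 + 3) \<Rightarrow> real ^ 3 \<Rightarrow> real ^ 3 \<Rightarrow> real ^ (3 + 3)" where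
  "adapted_vector p a b = cotangent_vector a (\<chi> k. b $ k - (\<Sum>j\<in>UNIV. a $ j * p $ Inr j) * p $ Inr k / 2
      + (if k = 1 then p $ Inl 2 * p $ Inr 3 * a $ 1 else 0))"

text \<open>The fibre corrections cancel the quadratic and the connection term of the metric,
  leaving the neutral pairing of base and fibre. This yields vectors of prescribed base part and
  prescribed norm at every point.\<close>

lemma mre_adapted_vector: "mre p (adapted_vector p a b) (adapted_vector p c d) = a \<bullet> d + c \<bullet> b"
  by (simp add: mre_eq adapted_vector_def pairing_def sum_3 inner_vec_def field_simps)

lemma has_signature_mre: "has_signature (mre p) 3 3"
proof -
  \<comment> \<open>Sum and difference of a null vector and half its dual partner: the norms are 1
    and -1, and the mixed products cancel.\<close>
  define e where "e i = (case i of Inl k \<Rightarrow> adapted_vector p (axis k 1) ((1/2) *\<^sub>R axis k 1)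
    | Inr k \<Rightarrow> adapted_vector p (axis k 1) ((-1/2) *\<^sub>R axis k 1))" for i :: "3 + 3"
  have e: "mre p (e i) (e j) = (if i = j then case i of Inl _ \<Rightarrow> 1 | Inr _ \<Rightarrow> -1 else 0)" for i j
    by (auto simp: e_def mre_adapted_vector inner_axis_axis split: sum.splits)
  have "{i. mre p (e i) (e i) = -1} = range Inr" "{i. mre p (e i) (e i) = 1} = range Inl"
    unfolding e by (auto split: sum.splits) (metis sum.exhaust rangeI)+
  then show ?thesis
    unfolding has_signature_def by (intro conjI exI[of _ e]) (simp_all add: e card_image)
qed

section \<open>The Levi-Civita connection and the Jacobi operator\<close>

text \<open>The Christoffel symbols of the metric, contracted with \<open>u\<close> and
  \<open>v\<close>. The term at \<open>k = 3\<close> in the base part is \<open>nabla\<close>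
  itself.\<close>

definition mre_connection :: "real ^ (3 + 3) \<Rightarrow> real ^ (3 + 3) \<Rightarrow> real ^ (3 + 3) \<Rightarrow> real ^ (3 + 3)" where
  "mre_connection p u v = cotangent_vector
    (\<chi> k. - (u $ Inl k * pairing v p + v $ Inl k * pairing u p) / 2
       + (if k = 3 then p $ Inl 2 * u $ Inl 1 * v $ Inl 1 else 0))
    (\<chi> k. (pairing u v + pairing v u) * p $ Inr k / 2
       + (pairing v p * u $ Inr k + pairing u p * v $ Inr k) / 2
       + (pairing u p * pairing v p - p $ Inl 2 * p $ Inr 3 * u $ Inl 1 * v $ Inl 1) * p $ Inr k
       + (if k = 1 then - (u $ Inl 2 * p $ Inr 3 + p $ Inl 2 * u $ Inr 3) * v $ Inl 1
            - (v $ Inl 2 * p $ Inr 3 + p $ Inl 2 * v $ Inr 3) * u $ Inl 1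
            - p $ Inl 2 * p $ Inr 3 * (u $ Inl 1 * pairing v p + v $ Inl 1 * pairing u p)
          else if k = 2 then p $ Inr 3 * u $ Inl 1 * v $ Inl 1 else 0))"

definition mre_connection_deriv ::
  "real ^ (3 + 3) \<Rightarrow> real ^ (3 + 3) \<Rightarrow> real ^ (3 + 3) \<Rightarrow> real ^ (3 + 3) \<Rightarrow> real ^ (3 + 3)" where
  "mre_connection_deriv p w u v = cotangent_vector
    (\<chi> k. - (u $ Inl k * pairing v w + v $ Inl k * pairing u w) / 2
       + (if k = 3 then w $ Inl 2 * u $ Inl 1 * v $ Inl 1 else 0))
    (\<chi> k. (pairing u v + pairing v u) * w $ Inr k / 2
       + (pairing v w * u $ Inr k + pairing u w * v $ Inr k) / 2
       + (pairing u p * pairing v p - p $ Inl 2 * p $ Inr 3 * u $ Inl 1 * v $ Inl 1) * w $ Inr k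
       + (pairing u w * pairing v p + pairing u p * pairing v w
           - (w $ Inl 2 * p $ Inr 3 + p $ Inl 2 * w $ Inr 3) * u $ Inl 1 * v $ Inl 1) * p $ Inr k
       + (if k = 1 then - (u $ Inl 2 * w $ Inr 3 + w $ Inl 2 * u $ Inr 3) * v $ Inl 1
            - (v $ Inl 2 * w $ Inr 3 + w $ Inl 2 * v $ Inr 3) * u $ Inl 1
            - (w $ Inl 2 * p $ Inr 3 + p $ Inl 2 * w $ Inr 3)
              * (u $ Inl 1 * pairing v p + v $ Inl 1 * pairing u p)
            - p $ Inl 2 * p $ Inr 3 * (u $ Inl 1 * pairing v w + v $ Inl 1 * pairing u w)
          else if k = 2 then w $ Inr 3 * u $ Inl 1 * v $ Inl 1 else 0))"

lemma has_derivative_vec_componentwise: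
  fixes f :: "'a::real_normed_vector \<Rightarrow> real ^ 'n"
  assumes "\<And>i. ((\<lambda>x. f x $ i) has_derivative (\<lambda>h. f' h $ i)) F"
  shows "(f has_derivative f') F"
proof -
  have "((\<lambda>x. \<Sum>i\<in>UNIV. f x $ i *\<^sub>R axis i (1::real)) has_derivative (\<lambda>h. \<Sum>i\<in>UNIV. f' h $ i *\<^sub>R axis i 1)) F"
    by (intro has_derivative_sum has_derivative_scaleR_left assms)
  then show ?thesis by (simp flip: vec_eq_sum_axis)
qed

lemma has_derivative_vec_nth: "((\<lambda>p. p $ i) has_derivative (\<lambda>w. w $ i)) F"
  by (rule bounded_linear_imp_has_derivative[OF bounded_linear_vec_nth])

lemma has_derivative_pairing: "(pairing u has_derivative pairing u) F"
  by (rule bounded_linear_imp_has_derivative) (simp add: linear_conv_bounded_linear[symmetric] pairing_linear)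

lemma has_derivative_mre_connection:
  "((\<lambda>p. mre_connection p u v) has_derivative (\<lambda>w. mre_connection_deriv p w u v)) (at p)"
proof (rule has_derivative_vec_componentwise)
  fix i :: "3 + 3"
  note der = derivative_eq_intros has_derivative_pairing has_derivative_vec_nth
  show "((\<lambda>p. mre_connection p u v $ i) has_derivative (\<lambda>w. mre_connection_deriv p w u v $ i)) (at p)"
  proof (cases i)
    case (Inl k)
    then show ?thesis
      by (cases "k = 3") (auto simp: mre_connection_def mre_connection_deriv_def fun_eq_iff field_simps intro!: der)
  next
    case (Inr k)
    consider "k = 1" | "k = 2" | "k \<noteq> 1" "k \<noteq> 2" by blast
    then show ?thesis
      by cases (auto simp: Inr mre_connection_def mre_connection_deriv_def fun_eq_iff field_simps intro!: der)
  qed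
qed

lemma mre_connection_nth:
  "mre_connection p u v $ Inl 1 = - (u $ Inl 1 * pairing v p + v $ Inl 1 * pairing u p) / 2"
  "mre_connection p u v $ Inl 2 = - (u $ Inl 2 * pairing v p + v $ Inl 2 * pairing u p) / 2"
  "mre_connection p u v $ Inl 3 = - (u $ Inl 3 * pairing v p + v $ Inl 3 * pairing u p) / 2
      + p $ Inl 2 * u $ Inl 1 * v $ Inl 1"
  by (simp_all add: mre_connection_def)

text \<open>The metric sees a connection vector only through its pairings and its first base
  component. This closed form and the next one avoid expanding all coordinates when compatibility
  and curvature are computed.\<close>

lemma pairing_mre_connection_left:
  "pairing (mre_connection p u v) w
    = - (pairing u w * pairing v p + pairing v w * pairing u p) / 2 + p $ Inl 2 * u $ Inl 1 * v $ Inl 1 * w $ Inr 3"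
  unfolding pairing_def[of _ w] mre_connection_nth by (simp add: field_simps)

lemma pairing_mre_connection_right:
  "pairing w (mre_connection p u v) = (pairing u v + pairing v u) * pairing w p / 2
    + (pairing v p * pairing w u + pairing u p * pairing w v) / 2
    + (pairing u p * pairing v p - p $ Inl 2 * p $ Inr 3 * u $ Inl 1 * v $ Inl 1) * pairing w p
    - w $ Inl 1 * ((u $ Inl 2 * p $ Inr 3 + p $ Inl 2 * u $ Inr 3) * v $ Inl 1
        + (v $ Inl 2 * p $ Inr 3 + p $ Inl 2 * v $ Inr 3) * u $ Inl 1
        + p $ Inl 2 * p $ Inr 3 * (u $ Inl 1 * pairing v p + v $ Inl 1 * pairing u p))
    + w $ Inl 2 * p $ Inr 3 * u $ Inl 1 * v $ Inl 1"
  by (simp add: pairing_def[of w] mre_connection_def field_simps)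

lemma mre_connection_sym: "mre_connection p u v = mre_connection p v u"
  by (auto simp: vec33_eq_iff mre_connection_def field_simps)

lemma bilinear_mre_connection: "bilinear (mre_connection p)"
proof -
  have "linear (mre_connection p u)" for u
    by (rule linearI) (simp_all add: vec33_eq_iff mre_connection_def field_simps)
  then show ?thesis
    unfolding bilinear_def using mre_connection_sym[of p] by (metis eta_contract_eq ext)
qed

lemma sum_mre_connection_axis:
  "(\<Sum>i\<in>UNIV. \<Sum>j\<in>UNIV. (u $ i * v $ j) *\<^sub>R mre_connection p (axis i 1) (axis j 1)) = mre_connection p u v"
proof -
  have "mre_connection p u v = mre_connection p (\<Sum>i\<in>UNIV. u $ i *\<^sub>R axis i 1) (\<Sum>j\<in>UNIV. v $ j *\<^sub>R axis j 1)"
    by (simp flip: vec_eq_sum_axis)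
  then show ?thesis
    by (simp add: bilinear_sum[OF bilinear_mre_connection] sum.cartesian_product case_prod_unfold
        bilinear_lmul[OF bilinear_mre_connection] bilinear_rmul[OF bilinear_mre_connection] mult.commute)
qed

text \<open>By uniqueness of the Levi-Civita connection it suffices to check symmetry and metric
  compatibility on the coordinate frame.\<close>

lemma levi_civita_mre: "levi_civita mre = (\<lambda>p i j. mre_connection p (axis i 1) (axis j 1))"
proof (rule levi_civita_eqI[OF pseudo_riemannian_mre])
  show "torsion_free (\<lambda>p i j. mre_connection p (axis i 1) (axis j 1))"
    unfolding torsion_free_iff using mre_connection_sym by blast
  have D: "((\<lambda>q. mre q u v) has_derivative (\<lambda>w. pairing u w * pairing v p + pairing u p * pairing v w
      - 2 * (w $ Inl 2 * p $ Inr 3 + p $ Inl 2 * w $ Inr 3) * u $ Inl 1 * v $ Inl 1)) (at p)" for u v p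
    unfolding mre_eq
    by (auto simp: fun_eq_iff field_simps intro!: derivative_eq_intros has_derivative_pairing has_derivative_vec_nth)
  have "frechet_derivative (\<lambda>q. mre q u v) (at p) w
      = mre p (mre_connection p w u) v + mre p u (mre_connection p w v)" for p u v w
    \<comment> \<open>The derivative is replaced while \<open>mre\<close> is still folded, because
      \<open>D\<close> is stated in that form.\<close>
    unfolding frechet_derivative_at[OF D, symmetric] unfolding mre_eq pairing_mre_connection_left
        pairing_mre_connection_right mre_connection_nth by (simp add: field_simps)
  then show "metric_compatible mre (\<lambda>p i j. mre_connection p (axis i 1) (axis j 1))"
    unfolding metric_compatible_iff[OF pseudo_riemannian_mre] by blast
qed

text \<open>Constant fields commute, so the bracket term of the curvature drops out. Each iterated
  covariant derivative is the derivative of the Christoffel term plus a composition of two such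
  terms.\<close>

lemma jacobi_mre_eq_connection:
  "jacobi mre p v y = mre_connection_deriv p y v v - mre_connection_deriv p v y v
    + mre_connection p y (mre_connection p v v) - mre_connection p v (mre_connection p y v)"
proof -
  let ?\<Gamma> = "\<lambda>p i j. mre_connection p (axis i 1) (axis j 1) :: real ^ (3 + 3)"
  have c: "covariant_deriv ?\<Gamma> (\<lambda>_. a) (\<lambda>_. b) = (\<lambda>p. mre_connection p a b)" for a b
    by (rule ext) (simp add: covariant_deriv_def sum_mre_connection_axis)
  have d: "covariant_deriv ?\<Gamma> (\<lambda>_. w) (\<lambda>p. mre_connection p a b) p
      = mre_connection_deriv p w a b + mre_connection p w (mre_connection p a b)" for a b w
    by (simp add: covariant_deriv_def sum_mre_connection_axis
        frechet_derivative_at[OF has_derivative_mre_connection, symmetric])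
  have "lie_bracket (\<lambda>_. y) (\<lambda>_. v) = (\<lambda>_. 0)"
    by (rule ext) (simp add: lie_bracket_def)
  then have z: "covariant_deriv ?\<Gamma> (lie_bracket (\<lambda>_. y) (\<lambda>_. v)) (\<lambda>_. v) p = 0"
    by (simp add: covariant_deriv_def)
  show ?thesis
    unfolding jacobi_def levi_civita_mre curvature_def z c d by simp
qed

text \<open>
  These are \<open>P v\<close>, \<open>\<phi>\<close> and \<open>Z\<close>, in this order, in the formula for the Jacobi operator.
\<close>
definition para_vector :: "real ^ (3 + 3) \<Rightarrow> real ^ (3 + 3) \<Rightarrow> real ^ (3 + 3)" where
  "para_vector p v = cotangent_vector (\<chi> k. v $ Inl k)
    (\<chi> k. - v $ Inr k - pairing v p * p $ Inr k + (if k = 1 then 2 * p $ Inl 2 * p $ Inr 3 * v $ Inl 1 else 0))"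

definition jordan_vector :: "real ^ (3 + 3) \<Rightarrow> real ^ (3 + 3)" where
  "jordan_vector v = cotangent_vector 0 (vector [- v $ Inl 2, v $ Inl 1, 0])"

definition coupling_vector :: "real ^ (3 + 3) \<Rightarrow> real ^ (3 + 3) \<Rightarrow> real ^ (3 + 3)" where
  "coupling_vector p v = cotangent_vector (vector [0, 0, v $ Inl 1])
    (vector [- v $ Inr 3 - p $ Inr 3 * pairing v p, 0, 0])"

lemma mre_connection_nth_Inr:
  "mre_connection p u v $ Inr k = (pairing u v + pairing v u) * p $ Inr k / 2
       + (pairing v p * u $ Inr k + pairing u p * v $ Inr k) / 2
       + (pairing u p * pairing v p - p $ Inl 2 * p $ Inr 3 * u $ Inl 1 * v $ Inl 1) * p $ Inr k
       + (if k = 1 then - (u $ Inl 2 * p $ Inr 3 + p $ Inl 2 * u $ Inr 3) * v $ Inl 1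
            - (v $ Inl 2 * p $ Inr 3 + p $ Inl 2 * v $ Inr 3) * u $ Inl 1
            - p $ Inl 2 * p $ Inr 3 * (u $ Inl 1 * pairing v p + v $ Inl 1 * pairing u p)
          else if k = 2 then p $ Inr 3 * u $ Inl 1 * v $ Inl 1 else 0)"
  by (simp add: mre_connection_def)

text \<open>The frame vectors are metric duals of simple covectors: \<open>para_vector p v\<close>
  gives the canonical symplectic form contracted with \<open>v\<close>, and
  \<open>jordan_vector v\<close> gives the contraction of the area form in the first two base
  coordinates.\<close>

lemma mre_frame:
  "mre p v y = pairing v y + pairing y v + pairing v p * pairing y p
    - 2 * p $ Inl 2 * p $ Inr 3 * v $ Inl 1 * y $ Inl 1"
  "mre p (para_vector p v) y = pairing v y - pairing y v"
  "mre p (jordan_vector v) y = v $ Inl 1 * y $ Inl 2 - v $ Inl 2 * y $ Inl 1"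
  "mre p (coupling_vector p v) y = v $ Inl 1 * y $ Inr 3 + p $ Inr 3 * v $ Inl 1 * pairing y p
    - (v $ Inr 3 + p $ Inr 3 * pairing v p) * y $ Inl 1"
  by (simp_all add: mre_eq para_vector_def jordan_vector_def coupling_vector_def pairing_def field_simps)

lemma jacobi_mre:
  "jacobi mre p v y = (mre p v v / 4) *\<^sub>R y - (mre p v y / 4) *\<^sub>R v
    - (3/4 * mre p (para_vector p v) y) *\<^sub>R para_vector p v
    + mre p (jordan_vector v) y *\<^sub>R coupling_vector p v + mre p (coupling_vector p v) y *\<^sub>R jordan_vector v"
proof -
  let ?R = "(mre p v v / 4) *\<^sub>R y - (mre p v y / 4) *\<^sub>R v
    - (3/4 * mre p (para_vector p v) y) *\<^sub>R para_vector p v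
    + mre p (jordan_vector v) y *\<^sub>R coupling_vector p v + mre p (coupling_vector p v) y *\<^sub>R jordan_vector v"
  \<comment> \<open>Products with the frame vectors must be rewritten before
    \<open>mre_frame(1)\<close>, which matches every inner product.\<close>
  note comps = jacobi_mre_eq_connection mre_frame(2-4) vector_add_component vector_minus_component vector_scaleR_component
  note defs = mre_frame(1) mre_connection_nth mre_connection_nth_Inr pairing_mre_connection_left pairing_mre_connection_right
  note defs' = mre_connection_deriv_def jordan_vector_def coupling_vector_def para_vector_def
  have "jacobi mre p v y $ Inl 1 = ?R $ Inl 1"
    unfolding comps unfolding defs by (simp add: defs' field_simps)
  moreover have "jacobi mre p v y $ Inl 2 = ?R $ Inl 2"
    unfolding comps unfolding defs by (simp add: defs' field_simps)
  moreover have "jacobi mre p v y $ Inl 3 = ?R $ Inl 3"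
    unfolding comps unfolding defs by (simp add: defs' field_simps)
  moreover have "jacobi mre p v y $ Inr 1 = ?R $ Inr 1"
    unfolding comps unfolding defs by (simp add: defs' field_simps)
  moreover have "jacobi mre p v y $ Inr 2 = ?R $ Inr 2"
    unfolding comps unfolding defs by (simp add: defs' field_simps)
  moreover have "jacobi mre p v y $ Inr 3 = ?R $ Inr 3"
    unfolding comps unfolding defs by (simp add: defs' field_simps)
  ultimately show ?thesis
    by (simp add: vec33_eq_iff forall_3)
qed

section \<open>Spectral properties of the Jacobi operator\<close>

lemma linear_jacobi_mre: "linear (jacobi mre p v)"
proof -
  have "linear (\<lambda>y. jacobi mre p v y)"
    unfolding jacobi_mre
    by (rule linearI) (simp_all add: bilinear_radd[OF bilinear_mre] bilinear_rmul[OF bilinear_mre] algebra_simps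
        add_divide_distrib)
  then show ?thesis by simp
qed

text \<open>The order is that of the hypotheses of \<open>char_poly_rank_one_perturbation\<close>.
  The first equation says that the para-complex structure is an anti-isometry.\<close>

lemma mre_frame_orthogonal:
  "mre p (para_vector p v) (para_vector p v) = - mre p v v"
  "mre p v (para_vector p v) = 0"
  "mre p v (jordan_vector v) = 0"
  "mre p v (coupling_vector p v) = 0"
  "mre p (para_vector p v) (jordan_vector v) = 0"
  "mre p (jordan_vector v) (jordan_vector v) = 0"
  "mre p (jordan_vector v) (coupling_vector p v) = 0"
proof -
  show "mre p v (para_vector p v) = 0" "mre p v (jordan_vector v) = 0" "mre p v (coupling_vector p v) = 0"
    unfolding mre_sym[of p v] unfolding mre_frame(2-4) by (simp_all add: pairing_def algebra_simps)
  show "mre p (para_vector p v) (para_vector p v) = - mre p v v"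
    unfolding mre_frame(2) unfolding mre_frame(1)
    by (simp add: para_vector_def pairing_def field_simps)
qed (simp_all only: mre_frame(2-4), simp_all add: jordan_vector_def coupling_vector_def pairing_def)

text \<open>The factor \<open>s\<close> serves two purposes: 1 for the Osserman conditions, and the
  inverse of the norm for the normalised spectrum.\<close>

lemma eigenvalue_mset_jacobi_mre:
  "eigenvalue_mset (\<lambda>y. s *\<^sub>R jacobi mre p v y) =
    {#0, of_real (s * mre p v v), of_real (s * mre p v v / 4), of_real (s * mre p v v / 4),
      of_real (s * mre p v v / 4), of_real (s * mre p v v / 4)#}"
proof -
  have "char_poly (complex_matrix (\<lambda>y. s *\<^sub>R jacobi mre p v y)) = [:0, 1:]
      * [:- complex_of_real (s * mre p v v), 1:] * [:- complex_of_real (s * mre p v v / 4), 1:] ^ (CARD(3 + 3) - 2)"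
    by (rule char_poly_rank_one_perturbation[OF bilinear_mre mre_sym refl mre_frame_orthogonal jacobi_mre]) simp
  moreover have "proots ([:0, 1:] * [:- a, 1:] * [:- b, 1:] ^ (CARD(3 + 3) - 2)) = {#0, a, b, b, b, b#}"
    for a b :: complex
    by (simp add: proots_mult proots_power numeral_eq_Suc del: mult_pCons_left mult_pCons_right power_Suc)
  ultimately show ?thesis
    by (simp only: eigenvalue_mset_def)
qed

lemma jacobi_jordan_vector: "jacobi mre p v (jordan_vector v) = (mre p v v / 4) *\<^sub>R jordan_vector v"
  unfolding jacobi_mre using mre_frame_orthogonal[of p v] mre_sym[of p "coupling_vector p v"] by simp

lemma ex_jacobi_generalized_eigenvector:
  "\<exists>x. jacobi mre p v x - (mre p v v / 4) *\<^sub>R x = (v $ Inl 1)\<^sup>2 *\<^sub>R jordan_vector v"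
proof
  \<comment> \<open>A fibre vector orthogonal to \<open>v\<close>, \<open>para_vector p v\<close>
    and \<open>jordan_vector v\<close>, so only the last term of \<open>jacobi_mre\<close> survives
    beside the scalar one.\<close>
  let ?x = "cotangent_vector 0 (vector [- v $ Inl 3, 0, v $ Inl 1])"
  have "mre p v ?x = 0" "mre p (para_vector p v) ?x = 0" "mre p (jordan_vector v) ?x = 0"
    "mre p (coupling_vector p v) ?x = (v $ Inl 1)\<^sup>2"
    unfolding mre_frame(2-4) unfolding mre_frame(1) by (simp_all add: pairing_def power2_eq_square)
  then show "jacobi mre p v ?x - (mre p v v / 4) *\<^sub>R ?x = (v $ Inl 1)\<^sup>2 *\<^sub>R jordan_vector v"
    unfolding jacobi_mre by simp
qed

lemma jordan_vector_eq_0_iff: "jordan_vector v = 0 \<longleftrightarrow> v $ Inl 1 = 0 \<and> v $ Inl 2 = 0"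
  by (auto simp: jordan_vector_def vec33_eq_iff forall_3)

lemma not_diagonalizable_jacobi_mre:
  assumes "v $ Inl 1 \<noteq> 0"
  shows "\<not> diagonalizable (jacobi mre p v)"
proof
  assume d: "diagonalizable (jacobi mre p v)"
  obtain x where x: "jacobi mre p v x - (mre p v v / 4) *\<^sub>R x = (v $ Inl 1)\<^sup>2 *\<^sub>R jordan_vector v"
    using ex_jacobi_generalized_eigenvector by blast
  have "jacobi mre p v x = (mre p v v / 4) *\<^sub>R x"
    by (rule diagonalizable_double_kernel[OF linear_jacobi_mre d])
      (simp add: x linear_cmul[OF linear_jacobi_mre] jacobi_jordan_vector)
  then show False
    using x assms by (simp add: jordan_vector_eq_0_iff)
qed

text \<open>\<open>jordan_vector v\<close> is an eigenvector with non-zero eigenvalue.\<close>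

lemma not_nilpotent_jacobi_mre:
  assumes "v $ Inl 1 \<noteq> 0" "mre p v v \<noteq> 0"
  shows "\<not> nilpotent (jacobi mre p v)"
proof -
  have "(jacobi mre p v ^^ k) (jordan_vector v) = (mre p v v / 4) ^ k *\<^sub>R jordan_vector v" for k
    by (induction k) (simp_all add: linear_cmul[OF linear_jacobi_mre] jacobi_jordan_vector)
  then show ?thesis
    using assms by (auto simp: nilpotent_def jordan_vector_eq_0_iff intro!: exI[of _ "jordan_vector v"])
qed

text \<open>The operator of \<open>u\<close> is annihilated by a cubic with the simple roots 0,
  \<open>q\<close> and \<open>q/4\<close>, as its \<open>jordan_vector\<close> is zero. A shared
  Jordan form would carry this over to \<open>w\<close>, contradicting the Jordan chain of
  \<open>w\<close> at \<open>q/4\<close>.\<close>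

lemma jacobi_mre_jordan_nf_differ:
  assumes u: "u $ Inl 1 = 0" "u $ Inl 2 = 0" and w: "w $ Inl 1 \<noteq> 0"
    and q: "mre p u u = q" "mre p w w = q" "q \<noteq> 0"
    and J: "jordan_nf (complex_matrix (jacobi mre p u)) J" "jordan_nf (complex_matrix (jacobi mre p w)) J"
  shows False
proof -
  define T where "T f c x = f x - c *\<^sub>R x" for f :: "real ^ (3 + 3) \<Rightarrow> real ^ (3 + 3)" and c x
  let ?f = "jacobi mre p u" and ?h = "jacobi mre p w"
  have linT: "T (jacobi mre p v) c (k *\<^sub>R x) = k *\<^sub>R T (jacobi mre p v) c x" for v c k x
    by (simp add: T_def linear_cmul[OF linear_jacobi_mre] algebra_simps)
  have f: "?f y = (q/4) *\<^sub>R y - (mre p u y / 4) *\<^sub>R u - (3/4 * mre p (para_vector p u) y) *\<^sub>R para_vector p u" for y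
  proof -
    have "jordan_vector u = 0" using u by (simp add: jordan_vector_eq_0_iff)
    then show ?thesis by (simp add: jacobi_mre q(1) bilinear_lzero[OF bilinear_mre])
  qed
  have fu: "?f u = 0"
    unfolding f using mre_frame_orthogonal(2)[of p u] mre_sym[of p u "para_vector p u"] q(1) by simp
  have fP: "?f (para_vector p u) = q *\<^sub>R para_vector p u"
    unfolding f using mre_frame_orthogonal(1,2)[of p u] q(1) by (simp add: algebra_simps flip: scaleR_add_left)
  \<comment> \<open>The innermost shift maps into the span of \<open>u\<close> and
    \<open>para_vector p u\<close>, eigenvectors for 0 and \<open>q\<close>.\<close>
  have "T ?f 0 (T ?f q (T ?f (q/4) x)) = 0" for x
    unfolding T_def f[of x] using fu fP
    by (simp add: linear_diff[OF linear_jacobi_mre] linear_cmul[OF linear_jacobi_mre] linear_neg[OF linear_jacobi_mre])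
  then have 0: "T ?h 0 (T ?h q (T ?h (q/4) x)) = 0" for x
    using jordan_nf_annihilator[OF linear_jacobi_mre linear_jacobi_mre J, where a = 0 and b = q and c = "q/4"]
    unfolding T_def by blast
  obtain x where x: "T ?h (q/4) x = (w $ Inl 1)\<^sup>2 *\<^sub>R jordan_vector w"
    using ex_jacobi_generalized_eigenvector[of p w] q(2) unfolding T_def by auto
  have ev: "T ?h c (jordan_vector w) = (q/4 - c) *\<^sub>R jordan_vector w" for c
    by (simp add: T_def jacobi_jordan_vector q(2) algebra_simps)
  have "(w $ Inl 1)\<^sup>2 *\<^sub>R (q/4 - q) *\<^sub>R (q/4 - 0) *\<^sub>R jordan_vector w = 0"
    using 0[of x] by (simp only: x linT ev)
  then show False
    using w q(3) by (simp add: jordan_vector_eq_0_iff)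
qed

lemma adapted_vector_nth_Inl [simp]: "adapted_vector p a b $ Inl k = a $ k"
  by (simp add: adapted_vector_def)

lemma mre_jordan_nf_not_constant:
  assumes "s \<noteq> 0"
  shows "\<nexists>J. \<forall>v. mre p v v = s \<longrightarrow> jordan_nf (complex_matrix (jacobi mre p v)) J"
proof
  assume "\<exists>J. \<forall>v. mre p v v = s \<longrightarrow> jordan_nf (complex_matrix (jacobi mre p v)) J"
  then obtain J where J: "\<And>v. mre p v v = s \<Longrightarrow> jordan_nf (complex_matrix (jacobi mre p v)) J" by blast
  \<comment> \<open>All \<open>e k\<close> have norm \<open>s\<close>; \<open>e 3\<close> lies over
    the third base direction, while \<open>e 1\<close> has non-zero first coordinate.\<close>
  define e where "e k = adapted_vector p (axis k 1) ((s / 2) *\<^sub>R axis k 1)" for k :: 3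
  have e: "mre p (e k) (e k) = s" for k
    by (simp add: e_def mre_adapted_vector inner_axis_axis)
  show False
    by (rule jacobi_mre_jordan_nf_differ[of "e 3" "e 1", OF _ _ _ e e assms J[OF e] J[OF e]])
      (simp_all add: e_def axis_def)
qed

section \<open>Genericity\<close>

lemma mre_generic_dense: "closure {v. v $ Inl 1 \<noteq> 0 \<and> mre p v v \<noteq> 0} = UNIV"
proof -
  \<comment> \<open>Norm 1 and first coordinate 1 make both factors of the polynomial below monic,
    hence non-zero for every \<open>v\<close>.\<close>
  define d where "d = adapted_vector p (axis 1 1) ((1/2) *\<^sub>R axis 1 1)"
  have d: "mre p d d = 1" "d $ Inl 1 = 1"
    by (simp_all add: d_def mre_adapted_vector inner_axis_axis)
  text \<open>
    On each line of direction \<open>d\<close> both conditions exclude only the finitely many roots of \<open>Q\<close>.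
  \<close>
  have "\<exists>w\<in>{v. v $ Inl 1 \<noteq> 0 \<and> mre p v v \<noteq> 0}. dist w v < e" if "e > 0" for v e
  proof -
    define Q where "Q = [:v $ Inl 1, 1:] * [:mre p v v, 2 * mre p v d, 1:]"
    have Q: "poly Q t = (v + t *\<^sub>R d) $ Inl 1 * mre p (v + t *\<^sub>R d) (v + t *\<^sub>R d)" for t
      using d mre_sym[of p d v]
      by (simp add: Q_def bilinear_radd[OF bilinear_mre] bilinear_rmul[OF bilinear_mre]
          bilinear_ladd[OF bilinear_mre] bilinear_lmul[OF bilinear_mre] algebra_simps)
    have "norm d \<noteq> 0" using d by auto
    then have "infinite {0<..<e / norm d}"
      using that by (intro infinite_Ioo) simp
    moreover have "Q \<noteq> 0" by (simp add: Q_def)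
    ultimately obtain t where t: "t \<in> {0<..<e / norm d}" "poly Q t \<noteq> 0"
      by (metis (mono_tags, lifting) finite_subset mem_Collect_eq poly_roots_finite subsetI)
    then have "dist (v + t *\<^sub>R d) v < e"
      using \<open>norm d \<noteq> 0\<close> by (simp add: dist_norm field_simps)
    then show ?thesis
      using t Q by (intro bexI[of _ "v + t *\<^sub>R d"]) auto
  qed
  then show ?thesis
    by (auto simp: closure_approachable)
qed

lemma mre_generic_open: "open {v. v $ Inl 1 \<noteq> 0 \<and> mre p v v \<noteq> 0}"
  unfolding mre_eq pairing_def
  by (intro open_Collect_conj open_Collect_neq continuous_intros)

theorem theorem2p3:
  fixes g :: "(3 + 3) metric_field"
  assumes g: "g = modified_riemannian_extension 1 nabla"
  shows
    "(pseudo_riemannian g \<and> (\<forall>p. has_signature (g p) 3 3) \<and> osserman g \<and>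
      (\<forall>p v. g p v v \<noteq> 0 \<longrightarrow>
         eigenvalue_mset (\<lambda>y. inverse (g p v v) *\<^sub>R jacobi g p v y) = {#0, 1, 1/4, 1/4, 1/4, 1/4#}))
     \<and> (\<forall>p. \<not> spacelike_jordan_osserman_at g p \<and> \<not> timelike_jordan_osserman_at g p)
     \<and> (\<forall>p. \<exists>U. open U \<and> closure U = UNIV \<and>
           (\<forall>v\<in>U. \<not> diagonalizable (jacobi g p v) \<and> \<not> nilpotent (jacobi g p v)))"
proof -
  have "osserman mre"
    unfolding osserman_def spacelike_osserman_def timelike_osserman_def
    \<comment> \<open>With factor 1 the multiset depends on \<open>v\<close> only through its norm,
      which is fixed in each condition.\<close>
    using eigenvalue_mset_jacobi_mre[of 1] by (auto intro!: exI)
  moreover have "eigenvalue_mset (\<lambda>y. inverse (mre p v v) *\<^sub>R jacobi mre p v y) = {#0, 1, 1/4, 1/4, 1/4, 1/4#}"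
    if "mre p v v \<noteq> 0" for p v
    using that by (simp add: eigenvalue_mset_jacobi_mre)
  moreover have "\<not> spacelike_jordan_osserman_at mre p" "\<not> timelike_jordan_osserman_at mre p" for p
    unfolding spacelike_jordan_osserman_at_def timelike_jordan_osserman_at_def
    using mre_jordan_nf_not_constant[of 1 p] mre_jordan_nf_not_constant[of "-1" p] by simp_all
  moreover have "\<exists>U. open U \<and> closure U = UNIV \<and>
      (\<forall>v\<in>U. \<not> diagonalizable (jacobi mre p v) \<and> \<not> nilpotent (jacobi mre p v))" for p
    using mre_generic_open mre_generic_dense not_diagonalizable_jacobi_mre not_nilpotent_jacobi_mre
    by (intro exI[of _ "{v. v $ Inl 1 \<noteq> 0 \<and> mre p v v \<noteq> 0}"]) blast
  ultimately show ?thesis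
    unfolding g using pseudo_riemannian_mre has_signature_mre by blast
qed

end
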